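(* Let $R$ be a subring of the field $\overline{\mathbb{Q}}$ of algebraic numbers (inside $\mathbb{C}$) such that the unit group $R^\times$ is finite. Then either $R=\mathbb{Z}$, or there exists an integer $d<0$ such that $R$ is an order in the imaginary quadratic field $\mathbb{Q}(\sqrt{d})$.
   Context: Rings are commutative with identity. An order in a quadratic number field $K$ is a subring of $K$ which is a finite-index subring of the ring of integers $\mathcal{O}_K$ (equivalently, a subring of $\mathcal{O}_K$ that is free of rank $2$ as an abelian group). *)

theory Defs
  imports Complex_Main "HOL-Algebra.Algebraic_Closure_Type" "HOL-Algebra.Generated_Fields"
begin

text \<open>
  All rings are subrings of the field of complex numbers, which serves as the ambient structure.
\<close>

abbreviation complex_field :: "complex ring" where
  "complex_field \<equiv> ring_of_type_algebra"

definition ring_of_integers :: "complex set \<Rightarrow> complex set" where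
  "ring_of_integers K = {x \<in> K. algebraic_int x}"

text \<open>
  Finite index is the index of additive groups: the set of additive cosets of \<open>R\<close> in the ring of
  integers of \<open>K\<close> is finite. The definition is meant for a number field \<open>K\<close>.
\<close>

definition order_in :: "complex set \<Rightarrow> complex set \<Rightarrow> bool" where
  "order_in K R \<longleftrightarrow>
     subring R (complex_field\<lparr>carrier := ring_of_integers K\<rparr>) \<and>
     finite (a_rcosets\<^bsub>complex_field\<lparr>carrier := ring_of_integers K\<rparr>\<^esub> R)"

text \<open>For \<open>d < 0\<close> this is always an imaginary quadratic field, since \<open>d\<close> is not a square.\<close>

definition quadratic_field :: "int \<Rightarrow> complex set" where
  "quadratic_field d = generate_field complex_field {csqrt (of_int d)}"

end

theory Submission
  imports Defs "HOL-Analysis.Kronecker_Approximation_Theorem"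
begin

text \<open>
  For \<open>\<alpha> \<in> R\<close> of degree \<open>n\<close>, an integer multiple \<open>\<beta>\<close> of \<open>\<alpha>\<close> generates a ring
  \<open>\<int>[\<beta>]\<close> with basis \<open>1, \<dots>, \<beta>\<^sup>n\<^sup>-\<^sup>1\<close>; measure elements of \<open>\<rat>(\<beta>)\<close> by the sum of the absolute
  values of their coordinates. By the pigeonhole principle only finitely many \<open>\<int>[\<beta>]\<close>-modules
  \<open>M \<supseteq> \<int>[\<beta>]\<close> in \<open>\<rat>(\<beta>)\<close> have no small nonzero element. If \<open>\<zeta>\<close> is a minimal element of a module
  \<open>L\<close>, then \<open>\<zeta>\<^sup>-\<^sup>1L\<close> is such an \<open>M\<close>, so infinitely many pairs \<open>(L, \<zeta>)\<close> with \<open>1 \<in> L \<subseteq> R\<close> yield infinitely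
  many units, namely quotients of the \<open>\<zeta>\<close>. If \<open>\<alpha>\<close> is not integral, take \<open>L = \<int> + \<int>\<alpha> + \<dots> + \<int>\<alpha>\<^sup>m\<close>
  for all large \<open>m\<close>. If \<open>\<beta>\<close> is real of degree at least 2, or nonreal of degree at least 3, take
  \<open>L = \<int>[\<beta>]\<close>, which by Dirichlet's theorem contains arbitrarily small complex numbers, and
  let \<open>\<zeta>\<close> run through elements of least height below given absolute values. Hence every element of \<open>R\<close>
  is a rational integer or an imaginary quadratic integer. The product of two purely imaginary elements
  of \<open>R\<close> is real, hence an integer, so only one quadratic field occurs. The same finiteness argument
  gives a common denominator for its integers over \<open>\<int>[s]\<close>, where \<open>s\<^sup>2 = d\<close>.
\<close>

section \<open>Common denominators, minima and integer polynomials\<close>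

lemma Rats_common_denominator:
  fixes c :: "nat \<Rightarrow> real"
  assumes "\<And>i. c i \<in> \<rat>"
  shows "\<exists>N::nat. N > 0 \<and> (\<forall>i<n. of_nat N * c i \<in> \<int>)"
proof (induction n)
  case 0
  then show ?case by auto
next
  case (Suc n)
  then obtain N :: nat where N: "N > 0" "\<forall>i<n. of_nat N * c i \<in> \<int>" by blast
  obtain a b :: int where ab: "b > 0" "c n = of_int a / of_int b"
    by (metis Rats_cases' assms)
  have "of_nat (N * nat b) * c i \<in> \<int>" if "i < Suc n" for i
  proof (cases "i = n")
    case True
    have "real (nat b) = of_int b" using ab by simp
    then have "of_nat (N * nat b) * c i = of_nat N * of_int a"
      using ab True by (simp add: field_simps)
    then show ?thesis by (metis Ints_mult Ints_of_int Ints_of_nat)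
  next
    case False
    have "of_nat (N * nat b) * c i = of_int b * (of_nat N * c i)"
      using ab by simp
    moreover have "of_nat N * c i \<in> \<int>" using N that False by simp
    ultimately show ?thesis by (metis Ints_mult Ints_of_int)
  qed
  moreover have "N * nat b > 0" using N ab by simp
  ultimately show ?case by blast
qed

text \<open>Minimising over the sublevel set of \<open>x\<close> suffices, because everything
  outside it exceeds \<open>h x\<close>. This yields elements of least height in infinite
  modules.\<close>

lemma ex_min_of_finite_sublevels:
  fixes h :: "'a \<Rightarrow> real"
  assumes "x \<in> S" "finite {y \<in> S. h y \<le> h x}"
  obtains z where "z \<in> S" "\<And>y. y \<in> S \<Longrightarrow> h z \<le> h y"
proof -
  define z where "z = arg_min_on h {y \<in> S. h y \<le> h x}"
  have ne: "{y \<in> S. h y \<le> h x} \<noteq> {}" using assms by auto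
  have z: "z \<in> S" "h z \<le> h x"
    using arg_min_if_finite(1)[OF assms(2) ne, of h] unfolding z_def by auto
  have "h z \<le> h y" if "y \<in> S" for y
  proof (cases "h y \<le> h x")
    case True
    then show ?thesis
      using arg_min_if_finite(2)[OF assms(2) ne, of h] that unfolding z_def
      by (metis (mono_tags, lifting) mem_Collect_eq not_le)
  qed (use z in auto)
  with z that show ?thesis by blast
qed

text \<open>Dividing out powers of the variable leaves a nonzero constant term, and the equation
  then exhibits this term as a multiple of \<open>x\<close>. Inverses in \<rat>(\<beta>) come from
  here.\<close>

lemma int_poly_root_divides_int:
  fixes x :: "'a::field_char_0"
  assumes "\<And>i. coeff p i \<in> \<int>" "p \<noteq> 0" "poly p x = 0" "x \<noteq> 0"
  shows "\<exists>q c. (\<forall>i. coeff q i \<in> \<int>) \<and> c \<noteq> 0 \<and> c \<in> \<int> \<and> c = x * poly q x"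
  using assms
proof (induction p)
  case (pCons a p)
  have cf: "coeff p i \<in> \<int>" for i
    using pCons.prems(1)[of "Suc i"] by simp
  have a: "a \<in> \<int>" using pCons.prems(1)[of 0] by simp
  have eq: "a = - (x * poly p x)"
    using pCons.prems(3) by (simp add: eq_neg_iff_add_eq_0)
  show ?case
  proof (cases "a = 0")
    case True
    with eq pCons.prems have "poly p x = 0" by auto
    then show ?thesis
      using pCons True cf by auto
  next
    case False
    then show ?thesis
      using eq a cf by (intro exI[of _ "- p"] exI[of _ a]) auto
  qed
qed simp

section \<open>Orders with a power basis\<close>

locale algebraic_subring =
  fixes R :: "complex set"
  assumes R_one: "1 \<in> R"
    and R_diff: "\<And>x y. x \<in> R \<Longrightarrow> y \<in> R \<Longrightarrow> x - y \<in> R"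
    and R_mult: "\<And>x y. x \<in> R \<Longrightarrow> y \<in> R \<Longrightarrow> x * y \<in> R"
    and R_algebraic: "\<And>x. x \<in> R \<Longrightarrow> algebraic x"
begin

lemma R_zero: "0 \<in> R"
  using R_diff[OF R_one R_one] by simp

lemma R_minus: "x \<in> R \<Longrightarrow> - x \<in> R"
  using R_diff[OF R_zero] by force

lemma R_add: "x \<in> R \<Longrightarrow> y \<in> R \<Longrightarrow> x + y \<in> R"
  using R_diff[of x "- y"] R_minus by auto

lemma R_of_nat: "of_nat k \<in> R"
  by (induction k) (auto simp: R_zero R_one R_add)

lemma R_of_int: "of_int k \<in> R"
  by (cases k) (use R_of_nat R_minus in \<open>auto simp del: of_nat_Suc\<close>)

lemma R_Ints: "x \<in> \<int> \<Longrightarrow> x \<in> R"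
  by (metis Ints_cases R_of_int)

lemma R_sum: "(\<And>i. i \<in> A \<Longrightarrow> f i \<in> R) \<Longrightarrow> sum f A \<in> R"
  by (induction A rule: infinite_finite_induct) (auto simp: R_zero R_add)

lemma R_power: "x \<in> R \<Longrightarrow> x ^ k \<in> R"
  by (induction k) (auto simp: R_one R_mult)

definition R_units :: "complex set" where
  "R_units = {x \<in> R. \<exists>y\<in>R. x * y = 1}"

end

text \<open>The assumptions make \<int>[\<beta>] a free abelian group on the powers of \<beta> below
  \<open>n\<close>. The relation for \<open>\<beta> ^ n\<close> excludes \<open>n = 0\<close>, where
  it would read 1 = 0.\<close>

locale integral_power_basis = algebraic_subring +
  fixes \<beta> :: complex and n :: nat
  assumes beta_in: "\<beta> \<in> R"
    and beta_integral: "\<exists>c::nat\<Rightarrow>int. \<beta> ^ n = (\<Sum>i<n. of_int (c i) * \<beta> ^ i)"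
    and beta_indep: "\<And>r :: nat \<Rightarrow> int. (\<Sum>i<n. of_int (r i) * \<beta> ^ i) = 0 \<Longrightarrow> \<forall>i<n. r i = 0"
begin

definition lin :: "(nat \<Rightarrow> real) \<Rightarrow> complex" where
  "lin c = (\<Sum>i<n. of_real (c i) * \<beta> ^ i)"

text \<open>The field \<rat>(\<beta>); likewise \<open>Ord\<close> is the ring \<int>[\<beta>].
  Rational coefficients are kept in type \<open>real\<close>, where heights take their
  values.\<close>

definition K :: "complex set" where
  "K = {lin c | c. \<forall>i. c i \<in> \<rat>}"

definition Ord :: "complex set" where
  "Ord = {lin c | c. \<forall>i. c i \<in> \<int>}"

text \<open>The choice is unique only at indices below \<open>n\<close>; beyond them, and outside
  \<open>K\<close>, the values are arbitrary.\<close>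

definition crd :: "complex \<Rightarrow> nat \<Rightarrow> real" where
  "crd x = (SOME c. (\<forall>i. c i \<in> \<rat>) \<and> x = lin c)"

text \<open>This is the l1 norm of the coordinate vector, not an arithmetic height: it scales
  linearly and depends on the basis.\<close>

definition height :: "complex \<Rightarrow> real" where
  "height x = (\<Sum>i<n. \<bar>crd x i\<bar>)"

lemma lin_add: "lin c + lin d = lin (\<lambda>i. c i + d i)"
  by (simp add: lin_def sum.distrib algebra_simps)

lemma lin_diff: "lin c - lin d = lin (\<lambda>i. c i - d i)"
  by (simp add: lin_def sum_subtractf algebra_simps)

lemma lin_scale: "of_real r * lin c = lin (\<lambda>i. r * c i)"
  by (simp add: lin_def sum_distrib_left algebra_simps)

lemma lin_zero: "lin (\<lambda>_. 0) = 0"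
  by (simp add: lin_def)

text \<open>Multiplying by a common denominator turns a rational relation into an integral one, to
  which \<open>beta_indep\<close> applies.\<close>

lemma lin_eq_0D:
  assumes "\<And>i. c i \<in> \<rat>" "lin c = 0" "i < n"
  shows "c i = 0"
proof -
  obtain N :: nat where N: "N > 0" "\<forall>i<n. of_nat N * c i \<in> \<int>"
    using Rats_common_denominator[of c n, OF assms(1)] by metis
  define r where "r i = \<lfloor>of_nat N * c i\<rfloor>" for i
  have r: "of_int (r i) = of_nat N * c i" if "i < n" for i
    using N(2) that unfolding r_def by (metis of_int_floor_cancel Ints_cases)
  have "(\<Sum>i<n. of_int (r i) * \<beta> ^ i) = of_nat N * lin c"
  proof -
    have "(of_int (r i) :: complex) = of_nat N * of_real (c i)" if "i < n" for i
      by (metis of_real_mult of_real_of_int_eq of_real_of_nat_eq r that)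
    then have "(\<Sum>i<n. of_int (r i) * \<beta> ^ i)
        = (\<Sum>i<n. of_nat N * (of_real (c i) * \<beta> ^ i))"
      by (intro sum.cong) auto
    then show ?thesis
      by (simp add: lin_def sum_distrib_left)
  qed
  then have "(\<Sum>i<n. of_int (r i) * \<beta> ^ i) = 0" using assms(2) by (metis mult_zero_right)
  then have "r i = 0" using assms(3) beta_indep by blast
  then have "of_nat N * c i = 0" using r[OF assms(3)] by (metis of_int_0)
  then show ?thesis using N(1) by simp
qed

lemma lin_inj:
  assumes "\<And>i. c i \<in> \<rat>" "\<And>i. d i \<in> \<rat>" "lin c = lin d" "i < n"
  shows "c i = d i"
  using lin_eq_0D[of "\<lambda>i. c i - d i" i] assms lin_diff[of c d] by auto

lemma K_lin: "(\<And>i. c i \<in> \<rat>) \<Longrightarrow> lin c \<in> K"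
  by (auto simp: K_def)

lemma crd_Rats: "x \<in> K \<Longrightarrow> crd x i \<in> \<rat>"
  and lin_crd: "x \<in> K \<Longrightarrow> lin (crd x) = x"
proof -
  have *: "(\<forall>i. crd x i \<in> \<rat>) \<and> x = lin (crd x)" if "x \<in> K"
  proof -
    have "\<exists>c. (\<forall>i. c i \<in> \<rat>) \<and> x = lin c" using that unfolding K_def by blast
    from someI_ex[OF this] show ?thesis unfolding crd_def .
  qed
  then show "x \<in> K \<Longrightarrow> crd x i \<in> \<rat>" "x \<in> K \<Longrightarrow> lin (crd x) = x" by auto
qed

lemma crd_lin: "(\<And>i. c i \<in> \<rat>) \<Longrightarrow> i < n \<Longrightarrow> crd (lin c) i = c i"
  by (rule lin_inj) (auto simp: crd_Rats lin_crd K_lin)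

lemma height_lin: "(\<And>i. c i \<in> \<rat>) \<Longrightarrow> height (lin c) = (\<Sum>i<n. \<bar>c i\<bar>)"
  by (simp add: height_def crd_lin)

lemma Ord_subset_K: "Ord \<subseteq> K"
  unfolding Ord_def K_def using Ints_subset_Rats by blast

lemma Ord_KI: "x \<in> Ord \<Longrightarrow> x \<in> K"
  using Ord_subset_K by blast

lemma K_zero: "0 \<in> K"
  using K_lin[of "\<lambda>_. 0"] by (simp add: lin_zero)

lemma K_add: "x \<in> K \<Longrightarrow> y \<in> K \<Longrightarrow> x + y \<in> K"
  by (metis (mono_tags, lifting) K_lin Rats_add crd_Rats lin_add lin_crd)

lemma K_diff: "x \<in> K \<Longrightarrow> y \<in> K \<Longrightarrow> x - y \<in> K"
  by (metis (mono_tags, lifting) K_lin Rats_diff crd_Rats lin_diff lin_crd)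

lemma K_scale: "r \<in> \<rat> \<Longrightarrow> x \<in> K \<Longrightarrow> of_real r * x \<in> K"
  by (metis (mono_tags, lifting) K_lin Rats_mult crd_Rats lin_scale lin_crd)

lemma K_sum: "(\<And>i. i \<in> A \<Longrightarrow> f i \<in> K) \<Longrightarrow> sum f A \<in> K"
  by (induction A rule: infinite_finite_induct) (auto simp: K_zero K_add)

lemma Ord_lin: "(\<And>i. c i \<in> \<int>) \<Longrightarrow> lin c \<in> Ord"
  by (auto simp: Ord_def)

lemma OrdE:
  assumes "x \<in> Ord"
  obtains c where "x = lin c" "\<And>i. c i \<in> \<int>"
  using assms by (auto simp: Ord_def)

lemma Ord_zero: "0 \<in> Ord"
  unfolding Ord_def using lin_zero by (auto intro!: exI[of _ "\<lambda>_. 0"])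

lemma Ord_add: "x \<in> Ord \<Longrightarrow> y \<in> Ord \<Longrightarrow> x + y \<in> Ord"
  by (elim OrdE) (simp add: lin_add Ord_lin)

lemma Ord_scale: "r \<in> \<int> \<Longrightarrow> x \<in> Ord \<Longrightarrow> of_real r * x \<in> Ord"
  by (elim OrdE) (simp add: lin_scale Ord_lin)

lemma Ord_scale_int: "x \<in> Ord \<Longrightarrow> of_int k * x \<in> Ord"
  using Ord_scale[of "of_int k"] by simp

lemma Ord_scale_nat: "x \<in> Ord \<Longrightarrow> of_nat k * x \<in> Ord"
  using Ord_scale_int[of x "int k"] by simp

lemma Ord_minus: "x \<in> Ord \<Longrightarrow> - x \<in> Ord"
  using Ord_scale_int[of x "- 1"] by simp

lemma Ord_diff: "x \<in> Ord \<Longrightarrow> y \<in> Ord \<Longrightarrow> x - y \<in> Ord"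
  using Ord_add[of x "- y"] Ord_minus by simp

lemma Ord_sum: "(\<And>i. i \<in> A \<Longrightarrow> f i \<in> Ord) \<Longrightarrow> sum f A \<in> Ord"
  by (induction A rule: infinite_finite_induct) (auto simp: Ord_zero Ord_add)

text \<open>The integral relation settles the exponent \<open>n\<close>. In the induction,
  multiplying \<open>lin c\<close> by \<beta> raises each exponent by one, hence at most to
  \<open>n\<close>.\<close>

lemma Ord_beta_power: "\<beta> ^ k \<in> Ord"
proof -
  have small: "\<beta> ^ i \<in> Ord" if "i < n" for i
  proof -
    have "lin (\<lambda>j. if j = i then 1 else 0) = (\<Sum>j<n. if j = i then \<beta> ^ j else 0)"
      unfolding lin_def by (rule sum.cong) auto
    also have "\<dots> = \<beta> ^ i"
      using that by simp
    finally show ?thesis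
      unfolding Ord_def by (auto intro!: exI[of _ "\<lambda>j. if j = i then 1 else 0"])
  qed
  have le: "\<beta> ^ i \<in> Ord" if "i \<le> n" for i
  proof (cases "i = n")
    case True
    obtain c :: "nat \<Rightarrow> int" where "\<beta> ^ n = (\<Sum>i<n. of_int (c i) * \<beta> ^ i)"
      using beta_integral by blast
    also have "\<dots> \<in> Ord"
      by (auto intro!: Ord_sum Ord_scale_int small)
    finally show ?thesis using True by simp
  qed (use small that in auto)
  show ?thesis
  proof (induction k)
    case 0
    then show ?case by (intro le) auto
  next
    case (Suc k)
    then obtain c where c: "\<beta> ^ k = lin c" "\<And>i. c i \<in> \<int>"
      by (auto simp: Ord_def)
    have "\<beta> ^ Suc k = (\<Sum>i<n. of_real (c i) * \<beta> ^ Suc i)"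
      by (simp add: c lin_def sum_distrib_left algebra_simps)
    also have "\<dots> \<in> Ord"
      by (intro Ord_sum Ord_scale c le) auto
    finally show ?case .
  qed
qed

lemma Ord_one: "1 \<in> Ord"
  using Ord_beta_power[of 0] by simp

lemma lin_mult: "lin c * lin d = (\<Sum>i<n. \<Sum>j<n. of_real (c i * d j) * \<beta> ^ (i + j))"
  by (simp add: lin_def sum_product power_add algebra_simps)

lemma Ord_mult: "x \<in> Ord \<Longrightarrow> y \<in> Ord \<Longrightarrow> x * y \<in> Ord"
  by (elim OrdE, simp only: lin_mult) (intro Ord_sum Ord_scale Ord_beta_power Ints_mult)

lemma Ord_power: "x \<in> Ord \<Longrightarrow> x ^ k \<in> Ord"
  by (induction k) (auto simp: Ord_one Ord_mult)

lemma K_mult: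
  assumes "x \<in> K" "y \<in> K" shows "x * y \<in> K"
proof -
  have "lin (crd x) * lin (crd y) \<in> K"
    unfolding lin_mult
    by (intro K_sum K_scale Ord_KI Ord_beta_power Rats_mult crd_Rats assms)
  then show ?thesis using assms by (simp add: lin_crd)
qed

lemma Ord_subset_R: "Ord \<subseteq> R"
proof
  fix x assume "x \<in> Ord"
  then obtain c where c: "x = lin c" "\<And>i. c i \<in> \<int>" by (auto simp: Ord_def)
  have "complex_of_real (c i) \<in> R" for i
    using c(2)[of i] by (auto elim!: Ints_cases simp: R_of_int)
  then show "x \<in> R"
    by (auto simp: c lin_def intro!: R_sum R_mult R_power beta_in)
qed

lemma K_denominator:
  assumes "x \<in> K"
  obtains N :: nat where "N > 0" "of_nat N * x \<in> Ord"
proof -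
  obtain N :: nat where N: "N > 0" "\<forall>i<n. of_nat N * crd x i \<in> \<int>"
    using Rats_common_denominator[of "crd x" n] crd_Rats[OF assms] by blast
  have "of_nat N * x = of_real (real N) * lin (crd x)" using lin_crd[OF assms] by simp
  also have "\<dots> = (\<Sum>i<n. of_real (of_nat N * crd x i) * \<beta> ^ i)"
    unfolding lin_scale by (simp add: lin_def)
  also have "\<dots> \<in> Ord"
    by (intro Ord_sum Ord_scale Ord_beta_power) (use N in auto)
  finally show ?thesis using N that by blast
qed

text \<open>A multiple \<open>y\<close> of \<open>x\<close> in \<open>Ord\<close> is algebraic as an
  element of \<open>R\<close>, so some nonzero integer \<open>c\<close> equals \<open>y\<close>
  times a polynomial in \<open>y\<close>. Dividing that polynomial value by \<open>c\<close> inverts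
  \<open>y\<close> within \<rat>(\<beta>).\<close>

lemma K_inverse:
  assumes "x \<in> K" "x \<noteq> 0"
  shows "inverse x \<in> K"
proof -
  obtain N :: nat where N: "N > 0" "of_nat N * x \<in> Ord"
    using K_denominator assms by blast
  define y where "y = of_nat N * x"
  have y: "y \<in> Ord" "y \<noteq> 0" using N assms by (auto simp: y_def)
  then have "algebraic y" using R_algebraic Ord_subset_R by blast
  then obtain p where "\<forall>i. coeff p i \<in> \<int>" "p \<noteq> 0" "poly p y = 0"
    unfolding algebraic_def by metis
  then obtain q c where q: "\<forall>i. coeff q i \<in> \<int>" "c \<noteq> 0" "c \<in> \<int>" "c = y * poly q y"
    using int_poly_root_divides_int[of p y] y by metis
  have qy: "poly q y \<in> Ord"
    unfolding poly_altdef
  proof (intro Ord_sum)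
    fix i
    obtain k where "coeff q i = of_int k" using q(1) Ints_cases by metis
    then show "coeff q i * y ^ i \<in> Ord" using Ord_scale_int Ord_power y by simp
  qed
  obtain k where k: "c = of_int k" using q(3) Ints_cases by metis
  have "inverse x = of_real (of_nat N / of_int k) * poly q y"
    using q(2,4) assms N k by (simp add: y_def field_simps)
  also have "\<dots> \<in> K"
    by (intro K_scale Ord_KI qy) auto
  finally show ?thesis .
qed

lemma K_divide: "x \<in> K \<Longrightarrow> y \<in> K \<Longrightarrow> y \<noteq> 0 \<Longrightarrow> x / y \<in> K"
  by (simp add: divide_inverse K_mult K_inverse)

section \<open>Heights and their comparison with absolute values\<close>

lemma height_nonneg: "height x \<ge> 0"
  by (simp add: height_def sum_nonneg)

lemma height_zero: "height 0 = 0"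
  using height_lin[of "\<lambda>_. 0"] by (simp add: lin_zero)

lemma height_eq_0D:
  assumes "x \<in> K" "height x = 0" shows "x = 0"
proof -
  have "\<forall>i<n. crd x i = 0"
    using assms(2) by (simp add: height_def sum_nonneg_eq_0_iff)
  then have "lin (crd x) = 0" by (simp add: lin_def)
  then show ?thesis using assms lin_crd by simp
qed

lemma height_add:
  assumes "x \<in> K" "y \<in> K" shows "height (x + y) \<le> height x + height y"
proof -
  have "height (x + y) = height (lin (\<lambda>i. crd x i + crd y i))"
    using lin_add[of "crd x" "crd y"] assms by (simp add: lin_crd)
  also have "\<dots> = (\<Sum>i<n. \<bar>crd x i + crd y i\<bar>)"
    by (rule height_lin) (simp add: crd_Rats assms)
  also have "\<dots> \<le> (\<Sum>i<n. \<bar>crd x i\<bar> + \<bar>crd y i\<bar>)"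
    by (intro sum_mono) auto
  finally show ?thesis by (simp add: height_def sum.distrib)
qed

lemma height_scale:
  assumes "x \<in> K" "r \<in> \<rat>" shows "height (of_real r * x) = \<bar>r\<bar> * height x"
proof -
  have "height (of_real r * x) = height (lin (\<lambda>i. r * crd x i))"
    using lin_scale[of r "crd x"] assms by (simp add: lin_crd)
  also have "\<dots> = (\<Sum>i<n. \<bar>r * crd x i\<bar>)"
    by (rule height_lin) (simp add: crd_Rats assms)
  finally show ?thesis by (simp add: height_def abs_mult sum_distrib_left)
qed

lemma height_sum:
  assumes "\<And>i. i \<in> A \<Longrightarrow> f i \<in> K"
  shows "height (sum f A) \<le> (\<Sum>i\<in>A. height (f i))"
  using assms
proof (induction A rule: infinite_finite_induct)
  case (insert x F)
  have "height (f x + sum f F) \<le> height (f x) + height (sum f F)"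
    by (intro height_add K_sum) (use insert in auto)
  with insert show ?case by fastforce
qed (auto simp: height_zero)

text \<open>One constant serves two estimates. The heights of \<open>\<beta> ^ k\<close> control
  products, whose exponents \<open>i + j\<close> stay below \<open>2 * n\<close>; the powers of
  \<open>norm \<beta>\<close> bound absolute values by heights. The summand 1 keeps it
  positive.\<close>

definition height_const :: real where
  "height_const = 1 + (\<Sum>k<2*n. height (\<beta> ^ k)) + (\<Sum>i<n. norm \<beta> ^ i)"

lemma height_const_pos: "height_const > 0"
  unfolding height_const_def by (intro add_pos_nonneg add_pos_nonneg sum_nonneg) (auto simp: height_nonneg)

lemma height_mult:
  assumes "x \<in> K" "y \<in> K"
  shows "height (x * y) \<le> height_const * height x * height y"
proof -
  have b: "height (\<beta> ^ k) \<le> height_const" if "k < 2 * n" for k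
  proof -
    have "height (\<beta> ^ k) \<le> (\<Sum>k<2*n. height (\<beta> ^ k))"
      by (intro member_le_sum) (use that height_nonneg in auto)
    moreover have "(\<Sum>i<n. norm \<beta> ^ i) \<ge> 0" by (intro sum_nonneg) auto
    ultimately show ?thesis by (simp add: height_const_def)
  qed
  have "x * y = (\<Sum>i<n. \<Sum>j<n. of_real (crd x i * crd y j) * \<beta> ^ (i + j))"
    using lin_mult[of "crd x" "crd y"] assms by (simp add: lin_crd del: of_real_mult)
  also have "height \<dots> \<le> (\<Sum>i<n. height (\<Sum>j<n. of_real (crd x i * crd y j) * \<beta> ^ (i + j)))"
    by (intro height_sum K_sum K_scale Ord_KI Ord_beta_power Rats_mult crd_Rats assms)
  also have "\<dots> \<le> (\<Sum>i<n. \<Sum>j<n. height (of_real (crd x i * crd y j) * \<beta> ^ (i + j)))"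
    by (intro sum_mono height_sum K_scale Ord_KI Ord_beta_power Rats_mult crd_Rats assms)
  also have "\<dots> = (\<Sum>i<n. \<Sum>j<n. \<bar>crd x i * crd y j\<bar> * height (\<beta> ^ (i + j)))"
    by (intro sum.cong refl height_scale Ord_KI Ord_beta_power Rats_mult crd_Rats assms)
  also have "\<dots> \<le> (\<Sum>i<n. \<Sum>j<n. \<bar>crd x i * crd y j\<bar> * height_const)"
    by (intro sum_mono mult_left_mono b) auto
  also have "\<dots> = height_const * height x * height y"
    by (simp add: height_def sum_product sum_distrib_left sum_distrib_right abs_mult mult_ac)
  finally show ?thesis .
qed

lemma norm_le_height:
  assumes "x \<in> K"
  shows "norm x \<le> height_const * height x"
proof -
  have b: "norm \<beta> ^ i \<le> height_const" if "i < n" for i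
  proof -
    have "norm \<beta> ^ i \<le> (\<Sum>i<n. norm \<beta> ^ i)"
      by (intro member_le_sum) (use that in auto)
    moreover have "(\<Sum>k<2*n. height (\<beta> ^ k)) \<ge> 0" by (intro sum_nonneg height_nonneg)
    ultimately show ?thesis by (simp add: height_const_def)
  qed
  have "norm x = norm (lin (crd x))" using assms by (simp add: lin_crd)
  also have "\<dots> \<le> (\<Sum>i<n. norm (of_real (crd x i) * \<beta> ^ i))"
    unfolding lin_def by (rule norm_sum)
  also have "\<dots> = (\<Sum>i<n. \<bar>crd x i\<bar> * norm \<beta> ^ i)"
    by (simp add: norm_mult norm_power)
  also have "\<dots> \<le> (\<Sum>i<n. \<bar>crd x i\<bar> * height_const)"
    by (intro sum_mono mult_left_mono b) auto
  also have "\<dots> = height_const * height x"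
    by (simp add: height_def sum_distrib_left mult.commute)
  finally show ?thesis .
qed

text \<open>Rounding down changes each coordinate by less than 1, so every class of \<open>K\<close>
  modulo \<open>Ord\<close> has a representative of height at most \<open>n\<close>.\<close>

lemma ex_Ord_close:
  assumes "x \<in> K"
  obtains z where "z \<in> Ord" "height (x - z) \<le> n"
proof -
  define z where "z = lin (\<lambda>i. of_int \<lfloor>crd x i\<rfloor>)"
  have "x - z = lin (\<lambda>i. crd x i - of_int \<lfloor>crd x i\<rfloor>)"
    using lin_diff[of "crd x" "\<lambda>i. of_int \<lfloor>crd x i\<rfloor>"] lin_crd[OF assms] by (simp add: z_def)
  also have "height \<dots> = (\<Sum>i<n. \<bar>crd x i - of_int \<lfloor>crd x i\<rfloor>\<bar>)"
    by (rule height_lin) (auto intro!: Rats_diff crd_Rats assms)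
  also have "\<dots> \<le> (\<Sum>i<n. 1)"
    by (intro sum_mono) linarith
  finally have "height (x - z) \<le> n" by simp
  moreover have "z \<in> Ord" by (auto simp: z_def Ord_def)
  ultimately show ?thesis using that by blast
qed

lemma crd_le_height: "i < n \<Longrightarrow> \<bar>crd x i\<bar> \<le> height x"
  unfolding height_def by (rule member_le_sum) auto

text \<open>This prepares the pigeonhole principle: \<open>F\<close> labels half-open cubes in
  coordinate space. Finitely many of them meet the region of height at most \<open>B\<close>, and
  points of one cube are close.\<close>

lemma height_boxes:
  assumes "\<epsilon> > 0"
  obtains F :: "complex \<Rightarrow> nat \<Rightarrow> int" and T where "finite T"
    "\<And>x. x \<in> K \<Longrightarrow> height x \<le> B \<Longrightarrow> F x \<in> T"
    "\<And>x y. x \<in> K \<Longrightarrow> y \<in> K \<Longrightarrow> F x = F y \<Longrightarrow> height (x - y) < \<epsilon>"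
proof -
  \<comment> \<open>The denominator \<open>n + 1\<close> makes the sum of \<open>n\<close>
    coordinate errors strictly smaller than \<epsilon>.\<close>
  define e where "e = \<epsilon> / (n + 1)"
  have e: "e > 0" using assms by (simp add: e_def)
  \<comment> \<open>\<open>restrict\<close> discards the arbitrary coordinates beyond
    \<open>n\<close> and places the labels in a finite extensional function space.\<close>
  define F where "F x = restrict (\<lambda>i. \<lfloor>crd x i / e\<rfloor>) {..<n}" for x
  define m where "m = \<lceil>B / e\<rceil> + 1"
  define T where "T = ({..<n} \<rightarrow>\<^sub>E {-m..m})"
  have "F x \<in> T" if "x \<in> K" "height x \<le> B" for x
  proof -
    have "\<lfloor>crd x i / e\<rfloor> \<in> {-m..m}" if i: "i < n" for i
    proof -
      have "- B \<le> crd x i" "crd x i \<le> B"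
        using crd_le_height[OF i, of x] \<open>height x \<le> B\<close> by linarith+
      then have "- (B / e) \<le> crd x i / e" "crd x i / e \<le> B / e"
        using e by (simp_all add: divide_simps)
      then have "- \<lceil>B / e\<rceil> - 1 \<le> \<lfloor>crd x i / e\<rfloor>" "\<lfloor>crd x i / e\<rfloor> \<le> \<lceil>B / e\<rceil> + 1" by linarith+
      then show ?thesis by (simp add: m_def)
    qed
    then show ?thesis by (auto simp: F_def T_def)
  qed
  moreover have "height (x - y) < \<epsilon>" if xy: "x \<in> K" "y \<in> K" "F x = F y" for x y
  proof -
    have c: "\<bar>crd x i - crd y i\<bar> \<le> e" if "i < n" for i
    proof -
      have "\<lfloor>crd x i / e\<rfloor> = \<lfloor>crd y i / e\<rfloor>"
        using fun_cong[OF xy(3), of i] that by (simp add: F_def)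
      then have "\<bar>crd x i / e - crd y i / e\<bar> \<le> 1" by linarith
      then have "\<bar>(crd x i - crd y i) / e\<bar> \<le> 1" by (simp add: diff_divide_distrib)
      then show ?thesis using e by (simp add: abs_divide)
    qed
    have "x - y = lin (\<lambda>i. crd x i - crd y i)"
      using lin_diff[of "crd x" "crd y"] xy by (simp add: lin_crd)
    also have "height \<dots> = (\<Sum>i<n. \<bar>crd x i - crd y i\<bar>)"
      by (rule height_lin) (auto intro!: Rats_diff crd_Rats xy)
    also have "\<dots> \<le> (\<Sum>i<n. e)" by (intro sum_mono c) auto
    also have "\<dots> < \<epsilon>" using assms by (simp add: e_def field_simps)
    finally show ?thesis .
  qed
  moreover have "finite T" by (auto simp: T_def intro!: finite_PiE)
  ultimately show ?thesis using that by blast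
qed

lemma Ord_height_ge_1:
  assumes "x \<in> Ord" "x \<noteq> 0" shows "height x \<ge> 1"
proof -
  obtain c where c: "x = lin c" "\<And>i. c i \<in> \<int>" using assms by (auto simp: Ord_def)
  have cr: "c i \<in> \<rat>" for i using c(2) Ints_subset_Rats by blast
  have "\<exists>i<n. c i \<noteq> 0"
  proof (rule ccontr)
    assume "\<not> ?thesis"
    then have "lin c = 0" unfolding lin_def by (intro sum.neutral) auto
    with assms(2) c(1) show False by simp
  qed
  then obtain i where i: "i < n" "c i \<noteq> 0" by blast
  have "1 \<le> \<bar>c i\<bar>" using i(2) c(2)[of i] by (simp add: Ints_nonzero_abs_ge1)
  also have "\<dots> \<le> height x" using crd_le_height[OF i(1), of x] crd_lin[of c i] cr i c by simp
  finally show ?thesis .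
qed

text \<open>Two points in the same small cube differ by an element whose multiple by
  \<open>N\<close> lies in \<open>Ord\<close> and has height below 1, hence is 0. So each cube
  contains at most one point of the set.\<close>

lemma finite_bounded_denominator:
  assumes "N \<in> \<int>" "N \<noteq> 0"
  shows "finite {x \<in> K. N * x \<in> Ord \<and> height x \<le> B}" (is "finite ?S")
proof -
  obtain k where k: "N = of_int k" using assms by (auto elim: Ints_cases)
  define a :: real where "a = \<bar>of_int k\<bar>"
  have a: "a > 0" using assms k by (simp add: a_def)
  obtain F :: "complex \<Rightarrow> nat \<Rightarrow> int" and T where F: "finite T"
    "\<And>x. x \<in> K \<Longrightarrow> height x \<le> B \<Longrightarrow> F x \<in> T"
    "\<And>x y. x \<in> K \<Longrightarrow> y \<in> K \<Longrightarrow> F x = F y \<Longrightarrow> height (x - y) < 1 / a"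
    by (rule height_boxes[of "1 / a" B]) (use a in auto)
  have "inj_on F ?S"
  proof (rule inj_onI)
    fix x y assume x: "x \<in> ?S" and y: "y \<in> ?S" and eq: "F x = F y"
    have "N * (x - y) \<in> Ord" using x y Ord_diff by (simp add: right_diff_distrib)
    moreover have "height (N * (x - y)) < 1"
    proof -
      have "height (of_real (of_int k) * (x - y)) = a * height (x - y)"
        unfolding a_def by (intro height_scale K_diff) (use x y in auto)
      also have "\<dots> < 1" using F(3)[of x y] x y eq a by (simp add: field_simps)
      finally show ?thesis by (simp add: k)
    qed
    ultimately have "N * (x - y) = 0" using Ord_height_ge_1 by force
    then show "x = y" using assms by simp
  qed
  moreover have "F ` ?S \<subseteq> T" using F by auto
  ultimately show ?thesis using F(1) inj_on_finite by blast
qed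

section \<open>Finiteness of separated overmodules\<close>

text \<open>The lower bound on heights expresses discreteness with a fixed gap; this is what bounds
  the denominators over \<open>Ord\<close>.\<close>

definition separated_overmodule :: "real \<Rightarrow> complex set \<Rightarrow> bool" where
  "separated_overmodule \<epsilon> M \<longleftrightarrow> Ord \<subseteq> M \<and> M \<subseteq> K \<and> (\<forall>x\<in>M. \<forall>y\<in>M. x - y \<in> M) \<and>
    (\<forall>x\<in>M. x \<noteq> 0 \<longrightarrow> \<epsilon> \<le> height x)"

text \<open>Reduce the multiples \<open>0 * x\<close>, ..., \<open>m * x\<close> modulo
  \<open>Ord\<close> to remainders of height at most \<open>n\<close>. With \<open>m\<close> cubes,
  two remainders share a cube; their difference lies in \<open>M\<close> and is shorter than the
  gap, so it is 0 and \<open>(l - k) * x\<close> is in \<open>Ord\<close> with \<open>l - k\<close>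
  between 1 and \<open>m\<close>. As \<open>m\<close> depends neither on \<open>M\<close> nor on
  \<open>x\<close>, the factorial of \<open>m\<close> works throughout.\<close>

lemma uniform_denominator:
  assumes "\<epsilon> > 0"
  shows "\<exists>N::nat. N > 0 \<and> (\<forall>M x. separated_overmodule \<epsilon> M \<longrightarrow> x \<in> M \<longrightarrow> of_nat N * x \<in> Ord)"
proof -
  obtain F :: "complex \<Rightarrow> nat \<Rightarrow> int" and T where F: "finite T"
    "\<And>x. x \<in> K \<Longrightarrow> height x \<le> n \<Longrightarrow> F x \<in> T"
    "\<And>x y. x \<in> K \<Longrightarrow> y \<in> K \<Longrightarrow> F x = F y \<Longrightarrow> height (x - y) < \<epsilon>"
    by (rule height_boxes[of \<epsilon> n]) (use assms in auto)
  define m where "m = card T"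
  have "of_nat (fact m) * x \<in> Ord" if M: "separated_overmodule \<epsilon> M" and x: "x \<in> M" for M x
  proof -
    have Md: "u - v \<in> M" if "u \<in> M" "v \<in> M" for u v
      using M that by (simp add: separated_overmodule_def)
    have MO: "u \<in> M" if "u \<in> Ord" for u
      using M that by (auto simp: separated_overmodule_def)
    have MK: "u \<in> K" if "u \<in> M" for u
      using M that by (auto simp: separated_overmodule_def)
    have Ma: "u + v \<in> M" if "u \<in> M" "v \<in> M" for u v
      using Md[OF that(1) Md[OF MO[OF Ord_zero] that(2)]] by simp
    have kx: "of_nat k * x \<in> M" for k
      by (induction k) (auto simp: algebra_simps Ma x MO Ord_zero)
    have "\<exists>z\<in>Ord. height (of_nat k * x - z) \<le> n" for k
      using ex_Ord_close[OF MK[OF kx[of k]]] by metis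
    then obtain z where z: "\<And>k. z k \<in> Ord" "\<And>k. height (of_nat k * x - z k) \<le> n"
      by metis
    define g where "g k = of_nat k * x - z k" for k
    have gM: "g k \<in> M" for k unfolding g_def by (intro Md kx MO z)
    have "(\<lambda>k. F (g k)) ` {0..m} \<subseteq> T"
      using F(2) MK[OF gM] z(2) by (auto simp: g_def)
    then have "card ((\<lambda>k. F (g k)) ` {0..m}) \<le> m"
      unfolding m_def by (intro card_mono F)
    then have "\<not> inj_on (\<lambda>k. F (g k)) {0..m}"
      using card_image[of "\<lambda>k. F (g k)" "{0..m}"] by force
    then obtain k l where kl: "k \<le> m" "l \<le> m" "k < l" "F (g k) = F (g l)"
      unfolding inj_on_def by (metis atLeastAtMost_iff linorder_neqE_nat)
    have "height (g l - g k) < \<epsilon>" using F(3)[OF MK[OF gM] MK[OF gM]] kl by metis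
    moreover have "g l - g k \<in> M" by (intro Md gM)
    ultimately have "g l - g k = 0" using M by (fastforce simp: separated_overmodule_def)
    then have "of_nat (l - k) * x = z l - z k"
      using kl by (simp add: g_def of_nat_diff algebra_simps)
    then have in_Ord: "of_nat (l - k) * x \<in> Ord" using z Ord_diff by simp
    have "l - k dvd fact m" using kl by (intro dvd_fact) auto
    then obtain j where j: "(fact m :: nat) = (l - k) * j" by (auto simp: dvd_def)
    have "of_nat (fact m) * x = of_nat j * (of_nat (l - k) * x)"
      unfolding j by (simp add: mult_ac)
    then show ?thesis using in_Ord Ord_scale_nat by metis
  qed
  then show ?thesis by (intro exI[of _ "fact m"]) auto
qed

text \<open>By the uniform denominator, every element of \<open>M\<close> is congruent modulo
  \<open>Ord\<close> to an element of \<open>M\<close> in the finite set \<open>S\<close>. Hence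
  \<open>M \<inter> S\<close> determines \<open>M\<close>.\<close>

lemma finite_separated_overmodules:
  assumes "\<epsilon> > 0"
  shows "finite {M. separated_overmodule \<epsilon> M}"
proof -
  obtain N :: nat where N: "N > 0"
    "\<And>M x. separated_overmodule \<epsilon> M \<Longrightarrow> x \<in> M \<Longrightarrow> of_nat N * x \<in> Ord"
    using uniform_denominator[OF assms] by metis
  define S where "S = {x \<in> K. of_nat N * x \<in> Ord \<and> height x \<le> n}"
  have "finite S"
    unfolding S_def by (rule finite_bounded_denominator) (use N in simp_all)
  have sub: "M1 \<subseteq> M2"
    if M1: "separated_overmodule \<epsilon> M1" and M2: "separated_overmodule \<epsilon> M2"
      and eq: "M1 \<inter> S = M2 \<inter> S" for M1 M2
  proof
    fix x assume x: "x \<in> M1"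
    have "x \<in> K" using M1 x by (auto simp: separated_overmodule_def)
    then obtain z where z: "z \<in> Ord" "height (x - z) \<le> n" using ex_Ord_close by blast
    have xz: "x - z \<in> M1" using M1 x z by (auto simp: separated_overmodule_def)
    then have "x - z \<in> S"
      using N(2)[OF M1 xz] z(2) M1 by (auto simp: S_def separated_overmodule_def)
    with xz have "x - z \<in> M2" using eq by blast
    moreover have "- z \<in> M2" using M2 Ord_minus[OF z(1)] by (auto simp: separated_overmodule_def)
    ultimately have "(x - z) - (- z) \<in> M2" using M2 unfolding separated_overmodule_def by blast
    then show "x \<in> M2" by simp
  qed
  have "inj_on (\<lambda>M. M \<inter> S) {M. separated_overmodule \<epsilon> M}"
  proof (rule inj_onI)
    fix M1 M2 assume "M1 \<in> {M. separated_overmodule \<epsilon> M}" "M2 \<in> {M. separated_overmodule \<epsilon> M}"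
      "M1 \<inter> S = M2 \<inter> S"
    then show "M1 = M2" using sub[of M1 M2] sub[of M2 M1] by (intro subset_antisym) simp_all
  qed
  moreover have "(\<lambda>M. M \<inter> S) ` {M. separated_overmodule \<epsilon> M} \<subseteq> Pow S" by blast
  ultimately show ?thesis using \<open>finite S\<close> by (meson finite_Pow_iff inj_on_finite)
qed

section \<open>Infinitely many units\<close>

text \<open>Dividing \<open>L i\<close> by \<open>\<zeta> i\<close> gives a separated overmodule: it
  contains \<open>Ord\<close> because \<open>\<zeta> i\<close> lies in \<open>L i\<close>, and
  \<open>min\<close> provides the gap. By finiteness infinitely many indices share one quotient
  module, and their modules \<open>L i\<close> are multiples of a single \<open>L k\<close>.\<close>

lemma infinite_units_of_modules:
  fixes L :: "'i \<Rightarrow> complex set" and \<zeta> :: "'i \<Rightarrow> complex"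
  assumes "infinite I" "\<epsilon> > 0"
    and inj: "inj_on (\<lambda>i. (\<zeta> i, L i)) I"
    and xi: "\<And>i. i \<in> I \<Longrightarrow> \<zeta> i \<in> L i" "\<And>i. i \<in> I \<Longrightarrow> \<zeta> i \<noteq> 0"
    and one: "\<And>i. i \<in> I \<Longrightarrow> 1 \<in> L i"
    and LK: "\<And>i. i \<in> I \<Longrightarrow> L i \<subseteq> K"
    and LR: "\<And>i. i \<in> I \<Longrightarrow> L i \<subseteq> R"
    and diff: "\<And>i x y. i \<in> I \<Longrightarrow> x \<in> L i \<Longrightarrow> y \<in> L i \<Longrightarrow> x - y \<in> L i"
    and mult: "\<And>i x y. i \<in> I \<Longrightarrow> x \<in> Ord \<Longrightarrow> y \<in> L i \<Longrightarrow> x * y \<in> L i"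
    and min: "\<And>i y. i \<in> I \<Longrightarrow> y \<in> L i \<Longrightarrow> y \<noteq> 0 \<Longrightarrow> \<epsilon> \<le> height (y / \<zeta> i)"
  shows "infinite R_units"
proof -
  define \<Lambda> where "\<Lambda> i = (\<lambda>x. x / \<zeta> i) ` L i" for i
  have "separated_overmodule \<epsilon> (\<Lambda> i)" if i: "i \<in> I" for i
    unfolding separated_overmodule_def
  proof (intro conjI subsetI ballI impI)
    fix x assume x: "x \<in> Ord"
    have "x = (x * \<zeta> i) / \<zeta> i" using xi(2)[OF i] by simp
    then show "x \<in> \<Lambda> i" using mult[OF i x xi(1)[OF i]] unfolding \<Lambda>_def by blast
  next
    fix x assume "x \<in> \<Lambda> i"
    then obtain y where y: "y \<in> L i" "x = y / \<zeta> i" by (auto simp: \<Lambda>_def)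
    have "y \<in> K" "\<zeta> i \<in> K" using y xi LK i by auto
    then show "x \<in> K" unfolding y(2) using xi(2)[OF i] by (intro K_divide)
  next
    fix x y assume "x \<in> \<Lambda> i" "y \<in> \<Lambda> i"
    then obtain u v where "u \<in> L i" "x = u / \<zeta> i" "v \<in> L i" "y = v / \<zeta> i"
      by (auto simp: \<Lambda>_def)
    then show "x - y \<in> \<Lambda> i"
      using diff[OF i] unfolding \<Lambda>_def by (metis diff_divide_distrib imageI)
  next
    fix x assume "x \<in> \<Lambda> i" "x \<noteq> 0"
    then show "\<epsilon> \<le> height x" using min[OF i] by (auto simp: \<Lambda>_def)
  qed
  then have "\<Lambda> ` I \<subseteq> {M. separated_overmodule \<epsilon> M}" by blast
  then have "finite (\<Lambda> ` I)" by (rule finite_subset) (rule finite_separated_overmodules[OF assms(2)])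
  then obtain k where k: "k \<in> I" "infinite {i \<in> I. \<Lambda> i = \<Lambda> k}"
    using pigeonhole_infinite[OF assms(1)] by metis
  define J where "J = {i \<in> I. \<Lambda> i = \<Lambda> k}"
  define u where "u i = \<zeta> i / \<zeta> k" for i
  have Lu: "L i = (\<lambda>x. u i * x) ` L k" if "i \<in> J" for i
  proof -
    have i: "i \<in> I" "\<Lambda> i = \<Lambda> k" using that by (auto simp: J_def)
    have "L i = (\<lambda>x. \<zeta> i * x) ` \<Lambda> i"
      using xi(2)[OF i(1)] by (simp add: \<Lambda>_def image_image)
    also have "\<dots> = (\<lambda>x. u i * x) ` L k"
      unfolding i(2) by (simp add: \<Lambda>_def image_image u_def)
    finally show ?thesis .
  qed
  have "u ` J \<subseteq> R_units"
  proof safe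
    fix i assume i: "i \<in> J"
    then have I: "i \<in> I" by (simp add: J_def)
    \<comment> \<open>Since 1 lies in \<open>L k\<close>, the factor \<open>u i\<close> lies in
      \<open>L i\<close>; since 1 lies in \<open>L i\<close>, its inverse lies in
      \<open>L k\<close>. Both modules are inside \<open>R\<close>.\<close>
    have "u i * 1 \<in> L i" unfolding Lu[OF i] using one[OF k(1)] by (rule imageI)
    then have "u i \<in> R" using LR[OF I] by auto
    moreover obtain y where "y \<in> L k" "1 = u i * y"
      using one[OF I] unfolding Lu[OF i] by auto
    ultimately show "u i \<in> R_units" using LR[OF k(1)] unfolding R_units_def
      by (metis (mono_tags, lifting) mem_Collect_eq subsetD)
  qed
  moreover have "inj_on u J"
  proof (rule inj_onI)
    fix i j assume ij: "i \<in> J" "j \<in> J" "u i = u j"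
    \<comment> \<open>Among indices with a common quotient, the unit determines both components of
      the pair on which injectivity was assumed.\<close>
    then have "\<zeta> i = \<zeta> j" using xi(2)[OF k(1)] by (simp add: u_def)
    moreover have "L i = L j" using Lu ij by metis
    ultimately show "i = j" using inj ij by (auto simp: inj_on_def J_def)
  qed
  ultimately show ?thesis using k(2) unfolding J_def
    by (meson inj_on_finite)
qed

text \<open>Among nonzero elements of \<open>Ord\<close> with absolute value below \<eta>, take
  \<open>x\<close> of least height. If \<open>y / x\<close> had height below
  \<open>inverse height_const\<close>, then \<open>y\<close> would be no larger than
  \<open>x\<close> in absolute value and strictly smaller in height, a contradiction.\<close>

lemma infinite_units_of_small_elements:
  assumes small: "\<And>\<eta>. \<eta> > 0 \<Longrightarrow> \<exists>x\<in>Ord. x \<noteq> 0 \<and> norm x < \<eta>"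
  shows "infinite R_units"
proof -
  \<comment> \<open>These are the elements admissible as \<zeta> for the constant module
    \<open>Ord\<close>; letting \<eta> tend to 0 yields infinitely many.\<close>
  define G where "G = {x \<in> Ord. x \<noteq> 0 \<and> (\<forall>y\<in>Ord. y \<noteq> 0 \<longrightarrow> inverse height_const \<le> height (y / x))}"
  have ex: "\<exists>x\<in>G. norm x < \<eta>" if "\<eta> > 0" for \<eta>
  proof -
    obtain x0 where x0: "x0 \<in> {x \<in> Ord. x \<noteq> 0 \<and> norm x < \<eta>}" using small \<open>\<eta> > 0\<close> by blast
    have fin: "finite {y \<in> {x \<in> Ord. x \<noteq> 0 \<and> norm x < \<eta>}. height y \<le> height x0}"
      by (rule finite_subset[OF _ finite_bounded_denominator[of 1 "height x0"]])
         (auto simp: Ord_KI)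
    obtain x where "x \<in> {x \<in> Ord. x \<noteq> 0 \<and> norm x < \<eta>}"
      "\<And>y. y \<in> {x \<in> Ord. x \<noteq> 0 \<and> norm x < \<eta>} \<Longrightarrow> height x \<le> height y"
      using ex_min_of_finite_sublevels[OF x0 fin] by blast
    then have x: "x \<in> Ord" "x \<noteq> 0" "norm x < \<eta>"
      and min: "\<And>y. y \<in> Ord \<Longrightarrow> y \<noteq> 0 \<Longrightarrow> norm y < \<eta> \<Longrightarrow> height x \<le> height y"
      by auto
    have "inverse height_const \<le> height (y / x)" if y: "y \<in> Ord" "y \<noteq> 0" for y
    proof (rule ccontr)
      assume "\<not> inverse height_const \<le> height (y / x)"
      then have lt: "height_const * height (y / x) < 1" using height_const_pos by (simp add: field_simps)
      have dK: "y / x \<in> K" using x y by (intro K_divide Ord_KI)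
      have "norm y = norm (y / x) * norm x" using x by (simp add: norm_divide)
      also have "\<dots> \<le> (height_const * height (y / x)) * norm x"
        by (intro mult_right_mono norm_le_height dK) auto
      also have "\<dots> \<le> 1 * norm x" using lt by (intro mult_right_mono) auto
      finally have "norm y < \<eta>" using x by simp
      then have "height x \<le> height y" using min y by blast
      also have "height y = height (y / x * x)" using x by simp
      also have "\<dots> \<le> height_const * height (y / x) * height x"
        by (intro height_mult dK Ord_KI x)
      also have "\<dots> < 1 * height x"
        using lt Ord_height_ge_1[OF x(1,2)] by (intro mult_strict_right_mono) auto
      finally show False by simp
    qed
    then show ?thesis using x by (auto simp: G_def)
  qed
  have "infinite G"
  proof
    assume fin: "finite G"
    have ne: "G \<noteq> {}" using ex[of 1] by auto
    have "Min (norm ` G) > 0" using fin ne by (auto simp: G_def)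
    then obtain x where "x \<in> G" "norm x < Min (norm ` G)" using ex by blast
    moreover from this have "Min (norm ` G) \<le> norm x" using fin by simp
    ultimately show False by simp
  qed
  show ?thesis
  proof (rule infinite_units_of_modules[where I = G and L = "\<lambda>_. Ord" and \<zeta> = "\<lambda>x. x" and \<epsilon> = "inverse height_const"])
    show "inverse height_const > 0" using height_const_pos by simp
  qed (use \<open>infinite G\<close> Ord_subset_K Ord_subset_R
         in \<open>auto simp: G_def Ord_one Ord_diff Ord_mult inj_on_def\<close>)
qed

text \<open>Dirichlet's theorem makes \<open>k * \<beta> - h\<close> arbitrarily small, and
  independence of 1 and \<beta> makes it nonzero.\<close>

lemma infinite_units_real:
  assumes "Im \<beta> = 0" "n \<ge> 2"
  shows "infinite R_units"
proof (rule infinite_units_of_small_elements)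
  fix \<eta> :: real assume "\<eta> > 0"
  obtain N where N: "N > 0" "1 / real N < \<eta>"
    using \<open>\<eta> > 0\<close> by (metis ex_inverse_of_nat_less inverse_eq_divide)
  obtain h k where hk: "0 < k" "\<bar>of_int k * Re \<beta> - of_int h\<bar> < 1 / N"
    using Dirichlet_approx[OF N(1)] by metis
  define x where "x = of_int k * \<beta> - of_int h"
  have "x \<noteq> 0"
  proof
    assume x0: "x = 0"
    define r where "r = (\<lambda>i::nat. if i = 0 then - h else if i = 1 then k else 0)"
    have "(\<Sum>i<n. of_int (r i) * \<beta> ^ i) = (\<Sum>i\<in>{0,1}. of_int (r i) * \<beta> ^ i)"
      by (rule sum.mono_neutral_right) (use assms(2) in \<open>auto simp: r_def\<close>)
    also have "\<dots> = 0" using x0 by (simp add: r_def x_def)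
    finally have "r 1 = 0" using beta_indep[of r] assms(2) by auto
    then show False using hk by (simp add: r_def)
  qed
  moreover have "x \<in> Ord"
    unfolding x_def
    using Ord_diff Ord_scale_int[of \<beta> k] Ord_scale_int[of 1 h] Ord_one Ord_beta_power[of 1] by auto
  moreover have "norm x < \<eta>"
  proof -
    have "x = of_real (of_int k * Re \<beta> - of_int h)"
      using assms(1) by (simp add: x_def complex_eq_iff)
    then have "norm x = \<bar>of_int k * Re \<beta> - of_int h\<bar>" by (simp only: norm_of_real)
    then show ?thesis using hk N by linarith
  qed
  ultimately show "\<exists>x\<in>Ord. x \<noteq> 0 \<and> norm x < \<eta>" by blast
qed

text \<open>A real quadratic equation expresses \<open>\<beta>\<^sup>2\<close> through 1 and
  \<beta>. Approximating its two coefficients simultaneously gives a small integer combination of 1,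
  \<beta> and \<open>\<beta>\<^sup>2\<close>, nonzero because these are independent.\<close>

lemma infinite_units_nonreal:
  assumes "Im \<beta> \<noteq> 0" "n \<ge> 3"
  shows "infinite R_units"
proof (rule infinite_units_of_small_elements)
  fix \<eta> :: real assume "\<eta> > 0"
  define s where "s = (\<lambda>i::nat. if i = 0 then - (norm \<beta>)\<^sup>2 else 2 * Re \<beta>)"
  have sq: "\<beta>\<^sup>2 = of_real (s 0) + of_real (s 1) * \<beta>"
    by (simp add: s_def complex_eq_iff cmod_power2) (simp add: power2_eq_square)
  \<comment> \<open>The two approximation errors enter with weights 1 and
    \<open>norm \<beta>\<close>, which explains the divisor.\<close>
  have pos: "\<eta> / (1 + norm \<beta>) > 0" using \<open>\<eta> > 0\<close> by (simp add: add_pos_nonneg)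
  obtain N where N: "N > 0" "1 / real N < \<eta> / (1 + norm \<beta>)"
    using ex_inverse_of_nat_less[OF pos] by (metis inverse_eq_divide)
  obtain k p where kp: "0 < k" "\<And>i. i < 2 \<Longrightarrow> \<bar>of_int k * s i - of_int (p i)\<bar> < 1 / N"
    using Dirichlet_approx_simult[OF N(1), of 2 s] by metis
  define x where "x = of_int k * \<beta>\<^sup>2 - of_int (p 0) - of_int (p 1) * \<beta>"
  have "x \<noteq> 0"
  proof
    assume x0: "x = 0"
    define r where "r = (\<lambda>i::nat. if i = 0 then - p 0 else if i = 1 then - p 1 else if i = 2 then k else 0)"
    have "(\<Sum>i<n. of_int (r i) * \<beta> ^ i) = (\<Sum>i\<in>{0,1,2}. of_int (r i) * \<beta> ^ i)"
      by (rule sum.mono_neutral_right) (use assms(2) in \<open>auto simp: r_def\<close>)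
    also have "\<dots> = 0" using x0 by (simp add: r_def x_def algebra_simps)
    finally have "r 2 = 0" using beta_indep[of r] assms(2) by auto
    then show False using kp by (simp add: r_def)
  qed
  moreover have "x \<in> Ord"
  proof -
    have "of_int k * \<beta> ^ 2 \<in> Ord" "of_int (p 0) * 1 \<in> Ord" "of_int (p 1) * \<beta> ^ 1 \<in> Ord"
      by (intro Ord_scale_int Ord_beta_power Ord_one)+
    then show ?thesis unfolding x_def using Ord_diff by simp
  qed
  moreover have "norm x < \<eta>"
  proof -
    have "x = of_real (of_int k * s 0 - of_int (p 0)) + of_real (of_int k * s 1 - of_int (p 1)) * \<beta>"
      by (simp add: x_def sq algebra_simps)
    also have "norm \<dots> \<le> norm (complex_of_real (of_int k * s 0 - of_int (p 0)))
        + norm (of_real (of_int k * s 1 - of_int (p 1)) * \<beta>)"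
      by (rule norm_triangle_ineq)
    also have "\<dots> = \<bar>of_int k * s 0 - of_int (p 0)\<bar> + \<bar>of_int k * s 1 - of_int (p 1)\<bar> * norm \<beta>"
      by (simp only: norm_of_real norm_mult)
    also have "\<dots> \<le> 1 / N + 1 / N * norm \<beta>"
      using kp(2)[of 0] kp(2)[of 1] by (intro add_mono mult_right_mono) auto
    also have "\<dots> = 1 / N * (1 + norm \<beta>)" by (simp add: ring_distribs)
    also have "\<dots> < \<eta> / (1 + norm \<beta>) * (1 + norm \<beta>)"
      using N by (intro mult_strict_right_mono) (auto simp: add_pos_nonneg)
    also have "\<dots> = \<eta>"
      using add_pos_nonneg[OF zero_less_one norm_ge_zero[of \<beta>]] by (simp add: field_simps)
    finally show ?thesis .
  qed
  ultimately show "\<exists>x\<in>Ord. x \<noteq> 0 \<and> norm x < \<eta>" by blast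
qed

section \<open>Modules spanned by the powers of a nonintegral element\<close>

definition powers :: "complex \<Rightarrow> nat \<Rightarrow> complex set" where
  "powers \<alpha> m = range (\<lambda>e :: nat \<Rightarrow> int. \<Sum>j\<le>m. of_int (e j) * \<alpha> ^ j)"

lemma powers_diff:
  assumes "x \<in> powers \<alpha> m" "y \<in> powers \<alpha> m" shows "x - y \<in> powers \<alpha> m"
proof -
  obtain d e where "x = (\<Sum>j\<le>m. of_int (d j) * \<alpha> ^ j)" "y = (\<Sum>j\<le>m. of_int (e j) * \<alpha> ^ j)"
    using assms by (auto simp: powers_def)
  then have "x - y = (\<Sum>j\<le>m. of_int (d j - e j) * \<alpha> ^ j)"
    by (simp add: sum_subtractf algebra_simps)
  then show ?thesis unfolding powers_def by - (rule range_eqI)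
qed

lemma powers_scale:
  assumes "x \<in> powers \<alpha> m" shows "of_int k * x \<in> powers \<alpha> m"
proof -
  obtain d where "x = (\<Sum>j\<le>m. of_int (d j) * \<alpha> ^ j)"
    using assms by (auto simp: powers_def)
  then have "of_int k * x = (\<Sum>j\<le>m. of_int (k * d j) * \<alpha> ^ j)"
    by (simp add: sum_distrib_left algebra_simps)
  then show ?thesis unfolding powers_def by - (rule range_eqI)
qed

lemma powers_zero: "0 \<in> powers \<alpha> m"
  unfolding powers_def by (rule range_eqI[of _ _ "\<lambda>_. 0"]) simp

lemma powers_add: "x \<in> powers \<alpha> m \<Longrightarrow> y \<in> powers \<alpha> m \<Longrightarrow> x + y \<in> powers \<alpha> m"
  using powers_diff[of x \<alpha> m "0 - y"] powers_diff[OF powers_zero, of y] by simp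

lemma powers_sum: "(\<And>i. i \<in> A \<Longrightarrow> f i \<in> powers \<alpha> m) \<Longrightarrow> sum f A \<in> powers \<alpha> m"
  by (induction A rule: infinite_finite_induct) (auto simp: powers_zero powers_add)

lemma powers_power:
  assumes "j \<le> m" shows "\<alpha> ^ j \<in> powers \<alpha> m"
proof -
  have "(\<Sum>i\<le>m. of_int (if i = j then 1 else 0) * \<alpha> ^ i) = (\<Sum>i\<le>m. if i = j then \<alpha> ^ i else 0)"
    by (rule sum.cong) auto
  also have "\<dots> = \<alpha> ^ j" using assms by simp
  finally have "\<alpha> ^ j = (\<Sum>i\<le>m. of_int (if i = j then 1 else 0) * \<alpha> ^ i)" by (rule sym)
  then show ?thesis unfolding powers_def by - (rule range_eqI)
qed

text \<open>Membership is a monic integral equation of degree \<open>k + 1\<close>. Consequently the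
  groups \<open>powers \<alpha> m\<close> increase strictly when \<alpha> is not integral.\<close>

lemma algebraic_int_if_power_mem:
  assumes "\<alpha> ^ Suc k \<in> powers \<alpha> k"
  shows "algebraic_int \<alpha>"
proof -
  obtain d where d: "\<alpha> ^ Suc k = (\<Sum>j\<le>k. of_int (d j) * \<alpha> ^ j)"
    using assms by (auto simp: powers_def)
  define q :: "complex poly" where "q = (\<Sum>j\<le>k. monom (of_int (d j)) j)"
  define p where "p = monom 1 (Suc k) - q"
  have q: "coeff q i = (if i \<le> k then of_int (d i) else 0)" for i
    by (simp add: q_def coeff_sum coeff_monom)
  have "degree p = Suc k"
  proof (rule antisym)
    show "degree p \<le> Suc k"
      by (rule degree_le) (auto simp: p_def q coeff_monom)
    show "Suc k \<le> degree p"
      by (rule le_degree) (simp add: p_def q coeff_monom)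
  qed
  then have "lead_coeff p = 1" by (simp add: p_def q coeff_monom)
  moreover have "\<forall>i. coeff p i \<in> \<int>" by (auto simp: p_def q coeff_monom)
  moreover have "poly p \<alpha> = 0"
    using d by (simp add: p_def q_def poly_sum poly_monom)
  ultimately show ?thesis by (rule algebraic_int.intros)
qed

text \<open>For large \<open>m\<close> the group \<open>powers \<alpha> m\<close> is an
  \<open>Ord\<close>-module with denominators dividing a power of \<open>a\<close>, so it has a
  nonzero element of least height, and submultiplicativity of heights yields the gap. The modules
  are pairwise distinct, so the pairs are too.\<close>

lemma infinite_units_nonintegral:
  fixes \<alpha> :: complex and a :: int
  assumes "\<alpha> \<in> R" "a \<noteq> 0" "\<beta> = of_int a * \<alpha>"
    and rel: "of_int a * \<alpha> ^ n = (\<Sum>i<n. of_int (c i) * \<alpha> ^ i)"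
    and "\<not> algebraic_int \<alpha>"
  shows "infinite R_units"
proof -
  let ?L = "powers \<alpha>"
  \<comment> \<open>For \<open>j \<le> m\<close>, multiplying \<open>\<alpha> ^ j\<close> by
    \<open>a ^ m\<close> gives \<open>a ^ (m - j) * \<beta> ^ j\<close>.\<close>
  have aO: "of_int a ^ m * x \<in> Ord" if x: "x \<in> ?L m" for m x
  proof -
    obtain d where d: "x = (\<Sum>j\<le>m. of_int (d j) * \<alpha> ^ j)" using x by (auto simp: powers_def)
    have "of_int a ^ m * x = (\<Sum>j\<le>m. of_int (d j) * (of_int (a ^ (m - j)) * \<beta> ^ j))"
      unfolding d sum_distrib_left
    proof (rule sum.cong)
      fix j assume "j \<in> {..m}"
      then have "complex_of_int a ^ m = of_int a ^ (m - j) * of_int a ^ j"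
        by (simp flip: power_add)
      then show "of_int a ^ m * (of_int (d j) * \<alpha> ^ j) = of_int (d j) * (of_int (a ^ (m - j)) * \<beta> ^ j)"
        by (simp add: assms(3) power_mult_distrib)
    qed simp
    also have "\<dots> \<in> Ord"
      by (intro Ord_sum Ord_scale_int Ord_beta_power)
    finally show ?thesis .
  qed
  have LK: "?L m \<subseteq> K" for m
  proof
    fix x assume "x \<in> ?L m"
    then have "of_real (inverse (of_int a ^ m)) * (of_int a ^ m * x) \<in> K"
      by (intro K_scale Ord_KI aO) auto
    then show "x \<in> K" using assms(2) by (simp add: field_simps)
  qed
  have LR: "?L m \<subseteq> R" for m
    using assms(1) by (auto simp: powers_def intro!: R_sum R_mult R_of_int R_power)
  have beta_L: "\<beta> * x \<in> ?L m" if m: "n \<le> Suc m" and x: "x \<in> ?L m" for m x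
  proof -
    obtain d where d: "x = (\<Sum>j\<le>m. of_int (d j) * \<alpha> ^ j)" using x by (auto simp: powers_def)
    have step: "of_int a * \<alpha> ^ Suc j \<in> ?L m" if "j \<le> m" for j
    proof (cases "j = m")
      case True
      \<comment> \<open>Only the top power leaves the span. Multiplying the relation for
        \<open>\<alpha> ^ n\<close> by \<open>\<alpha> ^ l\<close> rewrites
        \<open>a * \<alpha> ^ Suc m\<close> in lower powers; this is where
        \<open>n \<le> Suc m\<close> enters.\<close>
      define l where "l = Suc m - n"
      have "of_int a * \<alpha> ^ Suc j = of_int a * \<alpha> ^ n * \<alpha> ^ l"
        using \<open>n \<le> Suc m\<close> True by (simp add: l_def flip: power_add power_Suc)
      also have "\<dots> = (\<Sum>i<n. of_int (c i) * \<alpha> ^ (i + l))"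
        by (simp only: rel sum_distrib_right power_add mult.assoc)
      also have "\<dots> \<in> ?L m"
        by (intro powers_sum powers_scale powers_power) (use \<open>n \<le> Suc m\<close> in \<open>auto simp: l_def\<close>)
      finally show ?thesis .
    next
      case False
      then show ?thesis by (intro powers_scale powers_power) (use that in auto)
    qed
    have "\<beta> * x = (\<Sum>j\<le>m. of_int (d j) * (of_int a * \<alpha> ^ Suc j))"
      by (simp add: d assms(3) sum_distrib_left mult_ac)
    also have "\<dots> \<in> ?L m"
      by (intro powers_sum powers_scale step) auto
    finally show ?thesis .
  qed
  have OL: "z * x \<in> ?L m" if m: "n \<le> Suc m" and x: "x \<in> ?L m" and z: "z \<in> Ord" for m x z
  proof -
    obtain e where e: "z = lin e" "\<And>i. e i \<in> \<int>" using OrdE[OF z] by metis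
    have "\<beta> ^ i * x \<in> ?L m" for i
      by (induction i) (use m x beta_L in \<open>auto simp: mult.assoc\<close>)
    then have "of_real (e i) * (\<beta> ^ i * x) \<in> ?L m" for i
      using e(2)[of i] powers_scale by (auto elim!: Ints_cases)
    then have "(\<Sum>i<n. of_real (e i) * (\<beta> ^ i * x)) \<in> ?L m" by (rule powers_sum)
    then show ?thesis by (simp add: e lin_def sum_distrib_right mult.assoc)
  qed
  have L1: "1 \<in> ?L m" for m using powers_power[of 0 m \<alpha>] by simp
  have "\<exists>x. x \<in> ?L m \<and> x \<noteq> 0 \<and> (\<forall>y\<in>?L m. y \<noteq> 0 \<longrightarrow> height x \<le> height y)" for m
  proof -
    have "finite {y \<in> ?L m - {0}. height y \<le> height 1}"
      by (rule finite_subset[OF _ finite_bounded_denominator[of "of_int a ^ m" "height 1"]])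
         (use LK aO assms(2) in auto)
    then obtain x where "x \<in> ?L m - {0}" "\<And>y. y \<in> ?L m - {0} \<Longrightarrow> height x \<le> height y"
      using ex_min_of_finite_sublevels[of 1 "?L m - {0}" height] L1 by auto
    then show ?thesis by blast
  qed
  then obtain \<zeta> where \<zeta>: "\<And>m. \<zeta> m \<in> ?L m" "\<And>m. \<zeta> m \<noteq> 0"
    "\<And>m y. y \<in> ?L m \<Longrightarrow> y \<noteq> 0 \<Longrightarrow> height (\<zeta> m) \<le> height y" by metis
  have strict: "?L k \<noteq> ?L m" if "k < m" for k m
  proof
    assume "?L k = ?L m"
    moreover have "\<alpha> ^ Suc k \<in> ?L m" by (rule powers_power) (use that in simp)
    ultimately have "\<alpha> ^ Suc k \<in> ?L k" by blast
    then show False using algebraic_int_if_power_mem assms by blast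
  qed
  show ?thesis
  proof (rule infinite_units_of_modules[where I = "{n..}" and L = ?L and \<zeta> = \<zeta> and \<epsilon> = "inverse height_const"])
    show "infinite {n..}" by (rule infinite_Ici)
    show "inverse height_const > 0" using height_const_pos by simp
    show "inj_on (\<lambda>i. (\<zeta> i, ?L i)) {n..}"
      by (rule inj_onI) (metis linorder_neqE_nat prod.inject strict)
    show "inverse height_const \<le> height (y / \<zeta> m)" if y: "y \<in> ?L m" "y \<noteq> 0" for m y
    proof -
      have K: "y \<in> K" "\<zeta> m \<in> K" using LK y \<zeta> by auto
      then have dK: "y / \<zeta> m \<in> K" using \<zeta>(2) by (rule K_divide)
      have "height (\<zeta> m) \<le> height y" using \<zeta> y by blast
      also have "y = y / \<zeta> m * \<zeta> m" using \<zeta> by simp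
      also have "height \<dots> \<le> height_const * height (y / \<zeta> m) * height (\<zeta> m)"
        by (intro height_mult K dK)
      finally have le: "1 * height (\<zeta> m) \<le> height_const * height (y / \<zeta> m) * height (\<zeta> m)" by simp
      have "height (\<zeta> m) \<noteq> 0" using height_eq_0D K \<zeta> by blast
      then have "height (\<zeta> m) > 0" using height_nonneg[of "\<zeta> m"] by linarith
      with le have "1 \<le> height_const * height (y / \<zeta> m)" by (meson mult_right_le_imp_le)
      then show ?thesis using height_const_pos by (simp add: field_simps)
    qed
  qed (use \<zeta> L1 LK LR powers_diff OL in auto)
qed

end

section \<open>The elements of a ring with finitely many units\<close>

context algebraic_subring
begin

text \<open>Take the shortest initial segment of powers of \<alpha> that is dependent over \<int>.
  Minimality gives independence of the powers below the last one, and therefore a nonzero leading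
  coefficient.\<close>

lemma minimal_integer_relation:
  fixes \<alpha> :: complex
  assumes "algebraic \<alpha>"
  shows "\<exists>n a (c :: nat \<Rightarrow> int). a \<noteq> 0 \<and>
    of_int a * \<alpha> ^ n = (\<Sum>i<n. of_int (c i) * \<alpha> ^ i) \<and>
    (\<forall>r :: nat \<Rightarrow> int. (\<Sum>i<n. of_int (r i) * \<alpha> ^ i) = 0 \<longrightarrow> (\<forall>i<n. r i = 0))"
proof -
  \<comment> \<open>\<open>P m\<close> concerns the powers with exponent below \<open>m\<close>, so
    its least solution is the degree plus one.\<close>
  define P where "P m \<longleftrightarrow> (\<exists>r :: nat \<Rightarrow> int. (\<exists>i<m. r i \<noteq> 0) \<and> (\<Sum>i<m. of_int (r i) * \<alpha> ^ i) = 0)" for m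
  obtain p where p: "\<forall>i. coeff p i \<in> \<int>" "p \<noteq> 0" "poly p \<alpha> = 0"
    using assms unfolding algebraic_def by metis
  have "\<forall>i. \<exists>k. coeff p i = of_int k" using p(1) by (metis Ints_cases)
  then obtain r where r: "\<And>i. coeff p i = of_int (r i)" by metis
  have "P (Suc (degree p))"
    unfolding P_def
  proof (intro exI conjI)
    show "degree p < Suc (degree p)" by simp
    show "r (degree p) \<noteq> 0" using r[of "degree p"] p(2) by auto
    show "(\<Sum>i<Suc (degree p). of_int (r i) * \<alpha> ^ i) = 0"
      using p(3) by (simp add: poly_altdef r lessThan_Suc_atMost)
  qed
  define m where "m = (LEAST m. P m)"
  have m: "P m" unfolding m_def by (rule LeastI) fact
  have least: "\<not> P k" if "k < m" for k using not_less_Least that unfolding m_def by blast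
  have "m \<noteq> 0" using m by (auto simp: P_def)
  then obtain n where n: "m = Suc n" by (cases m) auto
  obtain r where r: "\<exists>i<m. r i \<noteq> 0" "(\<Sum>i<m. of_int (r i) * \<alpha> ^ i) = 0" using m by (auto simp: P_def)
  have indep: "\<forall>i<n. q i = 0" if "(\<Sum>i<n. of_int (q i) * \<alpha> ^ i) = 0" for q :: "nat \<Rightarrow> int"
    using least[of n] that n unfolding P_def by blast
  have "r n \<noteq> 0"
  proof
    assume rn: "r n = 0"
    then have "(\<Sum>i<n. of_int (r i) * \<alpha> ^ i) = 0" using r(2) by (simp add: n)
    then have "\<forall>i<n. r i = 0" by (rule indep)
    then show False using rn r(1) by (auto simp: n less_Suc_eq)
  qed
  moreover have "of_int (r n) * \<alpha> ^ n = (\<Sum>i<n. of_int (- r i) * \<alpha> ^ i)"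
    using r(2) by (simp add: n sum_negf eq_neg_iff_add_eq_0 add.commute)
  ultimately show ?thesis using indep
    by (intro exI[of _ n] exI[of _ "r n"] exI[of _ "\<lambda>i. - r i"]) blast
qed

text \<open>Each construction of infinitely many units is used contrapositively for
  \<open>\<beta> = a * \<alpha>\<close>. Thus \<alpha> is integral; if real it has degree 1 and is a
  rational algebraic integer; if nonreal its degree is below 3 and not 1.\<close>

lemma finite_units_cases:
  assumes fin: "finite R_units" and \<alpha>: "\<alpha> \<in> R"
  shows "\<alpha> \<in> \<int> \<or> (Im \<alpha> \<noteq> 0 \<and> algebraic_int \<alpha> \<and>
    (\<exists>a b c :: int. a \<noteq> 0 \<and> of_int a * \<alpha>\<^sup>2 + of_int b * \<alpha> + of_int c = 0))"
proof -
  obtain n a and c :: "nat \<Rightarrow> int" where a: "a \<noteq> 0"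
    and rel: "of_int a * \<alpha> ^ n = (\<Sum>i<n. of_int (c i) * \<alpha> ^ i)"
    and indep: "\<forall>r :: nat \<Rightarrow> int. (\<Sum>i<n. of_int (r i) * \<alpha> ^ i) = 0 \<longrightarrow> (\<forall>i<n. r i = 0)"
    using minimal_integer_relation[OF R_algebraic[OF \<alpha>]] by (elim exE conjE)
  have n: "n > 0" using rel a by (cases n) auto
  define \<beta> where "\<beta> = of_int a * \<alpha>"
  interpret integral_power_basis R \<beta> n
  proof
    show "\<beta> \<in> R" unfolding \<beta>_def by (intro R_mult R_of_int \<alpha>)
    \<comment> \<open>Scaling the relation by \<open>a ^ (n - 1)\<close> makes it monic in \<beta>,
      the spare powers of \<open>a\<close> going into the coefficients.\<close>
    have "\<beta> ^ n = of_int a ^ (n - 1) * (of_int a * \<alpha> ^ n)"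
      using n by (cases n) (simp_all add: \<beta>_def power_mult_distrib mult_ac)
    also have "\<dots> = (\<Sum>i<n. of_int (c i * a ^ (n - 1 - i)) * \<beta> ^ i)"
      unfolding rel sum_distrib_left
    proof (rule sum.cong)
      fix i assume "i \<in> {..<n}"
      then have "complex_of_int a ^ (n - 1) = of_int a ^ (n - 1 - i) * of_int a ^ i"
        by (simp flip: power_add)
      then show "of_int a ^ (n - 1) * (of_int (c i) * \<alpha> ^ i) = of_int (c i * a ^ (n - 1 - i)) * \<beta> ^ i"
        by (simp add: \<beta>_def power_mult_distrib)
    qed simp
    finally show "\<exists>c :: nat \<Rightarrow> int. \<beta> ^ n = (\<Sum>i<n. of_int (c i) * \<beta> ^ i)" by - (rule exI)
    show "\<forall>i<n. r i = 0" if "(\<Sum>i<n. of_int (r i) * \<beta> ^ i) = 0" for r :: "nat \<Rightarrow> int"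
    proof -
      have "(\<Sum>i<n. of_int (r i * a ^ i) * \<alpha> ^ i) = 0"
        using that by (simp add: \<beta>_def power_mult_distrib mult.assoc)
      from mp[OF spec[OF indep, of "\<lambda>i. r i * a ^ i"] this]
      have "\<forall>i<n. r i * a ^ i = 0" .
      then show ?thesis using a by simp
    qed
  qed
  have int: "algebraic_int \<alpha>"
    using infinite_units_nonintegral[OF \<alpha> a \<beta>_def rel] fin by blast
  have Im: "Im \<beta> = of_int a * Im \<alpha>" by (simp add: \<beta>_def)
  show ?thesis
  proof (cases "Im \<alpha> = 0")
    case True
    then have "n = 1" using infinite_units_real fin Im n by force
    then have "\<alpha> = of_int (c 0) / of_int a" using rel a by (simp add: field_simps)
    then have "\<alpha> \<in> \<int>" using rational_algebraic_int_is_int[OF int] by simp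
    then show ?thesis by simp
  next
    case False
    then have "n < 3" using infinite_units_nonreal fin Im a by force
    moreover have "n \<noteq> 1"
    proof
      assume "n = 1"
      then have "of_int a * \<alpha> = of_int (c 0)" using rel by simp
      from arg_cong[OF this, of Im] show False using False a by simp
    qed
    ultimately have "n = 2" using n by simp
    then have "of_int a * \<alpha>\<^sup>2 + of_int (- c 1) * \<alpha> + of_int (- c 0) = 0"
      using rel by (simp add: numeral_2_eq_2)
    then show ?thesis using False int a by blast
  qed
qed

end

section \<open>Bounded denominators of algebraic integers\<close>

context integral_power_basis
begin

text \<open>Choose \<open>Q\<close> for the powers below the degree. The monic equation writes every
  higher power as an integral combination of lower ones, so the same \<open>Q\<close>
  persists.\<close>

lemma common_denominator_powers:
  assumes x: "x \<in> K" "algebraic_int x"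
  obtains Q :: nat where "Q > 0" "\<And>k. of_nat Q * x ^ k \<in> Ord"
proof -
  obtain p where p: "lead_coeff p = 1" "\<forall>i. coeff p i \<in> \<int>" "poly p x = 0"
    using x(2) by (auto elim: algebraic_int.cases)
  have xK: "x ^ k \<in> K" for k
    by (induction k) (use x in \<open>auto simp: K_mult Ord_KI Ord_one\<close>)
  have "\<exists>Q::nat. Q > 0 \<and> (\<forall>k<m. of_nat Q * x ^ k \<in> Ord)" for m
  proof (induction m)
    case (Suc m)
    then obtain Q :: nat where Q: "Q > 0" "\<forall>k<m. of_nat Q * x ^ k \<in> Ord" by blast
    obtain N :: nat where N: "N > 0" "of_nat N * x ^ m \<in> Ord" using K_denominator[OF xK] by blast
    have "of_nat (Q * N) * x ^ k \<in> Ord" if "k < Suc m" for k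
    proof (cases "k = m")
      case True
      then show ?thesis using Ord_scale_nat[OF N(2), of Q] by (simp add: mult.assoc)
    next
      case False
      then have "of_nat Q * x ^ k \<in> Ord" using Q that by simp
      from Ord_scale_nat[OF this, of N] show ?thesis by (simp add: mult_ac)
    qed
    then show ?case using Q(1) N(1) by (intro exI[of _ "Q * N"]) simp
  qed (auto intro: exI[of _ 1])
  then obtain Q :: nat where Q: "Q > 0" "\<And>k. k < degree p \<Longrightarrow> of_nat Q * x ^ k \<in> Ord" by blast
  have "of_nat Q * x ^ k \<in> Ord" for k
  proof (induction k rule: less_induct)
    case (less k)
    show ?case
    proof (cases "k < degree p")
      case False
      have "0 = (\<Sum>i<degree p. coeff p i * x ^ i) + x ^ degree p"
        using p(1,3) by (simp add: poly_altdef flip: lessThan_Suc_atMost)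
      then have "x ^ degree p = - (\<Sum>i<degree p. coeff p i * x ^ i)"
        by (simp add: eq_neg_iff_add_eq_0 add.commute)
      moreover have "x ^ k = x ^ (k - degree p) * x ^ degree p"
        using False by (simp flip: power_add)
      ultimately have "of_nat Q * x ^ k =
          - (\<Sum>i<degree p. coeff p i * (of_nat Q * x ^ (k - degree p + i)))"
        by (simp add: sum_distrib_left power_add mult_ac)
      also have "\<dots> \<in> Ord"
      proof (intro Ord_minus Ord_sum)
        fix i assume "i \<in> {..<degree p}"
        then have "of_nat Q * x ^ (k - degree p + i) \<in> Ord" using False less by simp
        moreover obtain j where "coeff p i = of_int j" using p(2) by (metis Ints_cases)
        ultimately show "coeff p i * (of_nat Q * x ^ (k - degree p + i)) \<in> Ord"
          using Ord_scale_int by simp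
      qed
      finally show ?thesis .
    qed (use Q in auto)
  qed
  with Q(1) that show ?thesis by blast
qed

text \<open>
  \<open>Ord\<close> adjoined the algebraic integer \<open>x\<close> still has bounded denominators, so the powers of its
  nonzero elements stay away from 0, which makes it a separated overmodule.
\<close>

lemma algebraic_int_uniform_denominator:
  assumes ge1: "\<And>y. y \<in> Ord \<Longrightarrow> y \<noteq> 0 \<Longrightarrow> norm y \<ge> 1"
  shows "\<exists>N::nat. N > 0 \<and> (\<forall>x\<in>K. algebraic_int x \<longrightarrow> of_nat N * x \<in> Ord)"
proof -
  obtain N :: nat where N: "N > 0"
    "\<And>M x. separated_overmodule (inverse height_const) M \<Longrightarrow> x \<in> M \<Longrightarrow> of_nat N * x \<in> Ord"
    using uniform_denominator[of "inverse height_const"] height_const_pos by auto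
  have "of_nat N * x \<in> Ord" if x: "x \<in> K" "algebraic_int x" for x
  proof -
    obtain Q :: nat where Q: "Q > 0" "\<And>k. of_nat Q * x ^ k \<in> Ord"
      using common_denominator_powers[OF x] by blast
    define M where "M = {poly f x | f. \<forall>i. coeff f i \<in> Ord}"
    have MI: "poly f x \<in> M" if "\<And>i. coeff f i \<in> Ord" for f
      using that by (auto simp: M_def)
    have QM: "of_nat Q * y \<in> Ord" if y: "y \<in> M" for y
    proof -
      obtain f where f: "y = poly f x" "\<And>i. coeff f i \<in> Ord" using y by (auto simp: M_def)
      have "of_nat Q * y = (\<Sum>i\<le>degree f. coeff f i * (of_nat Q * x ^ i))"
        by (simp add: f(1) poly_altdef sum_distrib_left mult_ac)
      also have "\<dots> \<in> Ord" by (intro Ord_sum Ord_mult f Q)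
      finally show ?thesis .
    qed
    have M_power: "y ^ k \<in> M" if y: "y \<in> M" for y k
    proof -
      obtain f where f: "y = poly f x" "\<And>i. coeff f i \<in> Ord" using y by (auto simp: M_def)
      have "coeff (f ^ k) i \<in> Ord" for i
      proof (induction k arbitrary: i)
        case 0
        then show ?case by (auto simp: coeff_1 Ord_one Ord_zero)
      next
        case (Suc k)
        then show ?case by (auto simp: coeff_mult intro!: Ord_sum Ord_mult f)
      qed
      from MI[OF this] show ?thesis by (simp add: f)
    qed
    have norm_ge: "norm y \<ge> 1" if y: "y \<in> M" "y \<noteq> 0" for y
    proof (rule ccontr)
      assume "\<not> 1 \<le> norm y"
      \<comment> \<open>For such \<open>k\<close>, the element \<open>Q * y ^ k\<close> of
        \<open>Ord\<close> is nonzero with absolute value below 1.\<close>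
      then obtain k where k: "norm y ^ k < inverse (real Q)"
        using real_arch_pow_inv[of "inverse (real Q)" "norm y"] Q(1) by auto
      have "norm (of_nat Q * y ^ k) \<ge> 1"
        using y Q(1) by (intro ge1 QM M_power) auto
      then show False using k Q(1) by (simp add: norm_mult norm_power field_simps)
    qed
    have "separated_overmodule (inverse height_const) M"
      unfolding separated_overmodule_def
    proof (intro conjI subsetI ballI impI)
      fix y assume "y \<in> Ord"
      then show "y \<in> M" using MI[of "[:y:]"] by (auto simp: coeff_pCons Ord_zero split: nat.splits)
    next
      fix y assume y: "y \<in> M"
      have "of_real (inverse (real Q)) * (of_nat Q * y) \<in> K"
        by (intro K_scale Ord_KI QM y) auto
      moreover have "of_real (inverse (real Q)) * (of_nat Q * y) = y" using Q(1) by simp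
      ultimately show "y \<in> K" by metis
      \<comment> \<open>The bound \<open>norm y \<ge> 1\<close> becomes a height bound through
        \<open>norm_le_height\<close>, which fixes the gap.\<close>
      then show "inverse height_const \<le> height y" if "y \<noteq> 0"
        using norm_le_height[of y] norm_ge[OF y that] height_const_pos by (simp add: field_simps)
    next
      fix y z assume "y \<in> M" "z \<in> M"
      then obtain f g where "y = poly f x" "\<And>i. coeff f i \<in> Ord" "z = poly g x" "\<And>i. coeff g i \<in> Ord"
        by (auto simp: M_def)
      then show "y - z \<in> M" using MI[of "f - g"] Ord_diff by simp
    qed
    moreover have "x \<in> M"
      using MI[of "[:0, 1:]"] by (auto simp: coeff_pCons Ord_zero Ord_one split: nat.splits)
    ultimately show ?thesis using N(2) by blast
  qed
  with N(1) show ?thesis by blast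
qed

end

section \<open>Orders in quadratic fields\<close>

lemma complex_field_simps [simp]:
  "carrier complex_field = UNIV" "monoid.mult complex_field = (*)" "one complex_field = 1"
  "zero complex_field = 0" "add complex_field = (+)"
  by (simp_all add: ring_of_type_algebra_def)

lemma complex_field_a_inv [simp]: "a_inv complex_field x = - x"
  unfolding a_inv_def m_inv_def
  by (rule the_equality) (auto simp: eq_neg_iff_add_eq_0 add.commute)

lemma complex_field_m_inv: "x \<noteq> 0 \<Longrightarrow> m_inv complex_field x = inverse x"
  unfolding m_inv_def
  by (rule the_equality) (auto simp: field_simps)

lemma quadratic_field_closed:
  shows "1 \<in> quadratic_field d"
    and "csqrt (of_int d) \<in> quadratic_field d"
    and "x \<in> quadratic_field d \<Longrightarrow> - x \<in> quadratic_field d"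
    and "x \<in> quadratic_field d \<Longrightarrow> inverse x \<in> quadratic_field d"
    and "x \<in> quadratic_field d \<Longrightarrow> y \<in> quadratic_field d \<Longrightarrow> x + y \<in> quadratic_field d"
    and "x \<in> quadratic_field d \<Longrightarrow> y \<in> quadratic_field d \<Longrightarrow> x * y \<in> quadratic_field d"
proof -
  show "1 \<in> quadratic_field d"
    using generate_field.one[of complex_field] by (simp add: quadratic_field_def)
  show "csqrt (of_int d) \<in> quadratic_field d"
    unfolding quadratic_field_def by (rule generate_field.incl) simp
  show "- x \<in> quadratic_field d" if "x \<in> quadratic_field d"
    using generate_field.a_inv[of x complex_field] that by (simp add: quadratic_field_def)
  show "x + y \<in> quadratic_field d" if "x \<in> quadratic_field d" "y \<in> quadratic_field d" for x y
    using generate_field.eng_add[of x complex_field _ y] that by (simp add: quadratic_field_def)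
  show "x * y \<in> quadratic_field d" if "x \<in> quadratic_field d" "y \<in> quadratic_field d" for x y
    using generate_field.eng_mult[of x complex_field _ y] that by (simp add: quadratic_field_def)
  show "inverse x \<in> quadratic_field d" if "x \<in> quadratic_field d"
  proof (cases "x = 0")
    case False
    then show ?thesis
      using generate_field.m_inv[of x complex_field] that
      by (simp add: quadratic_field_def complex_field_m_inv)
  qed (use that in simp)
qed

lemma quadratic_field_of_int: "of_int k \<in> quadratic_field d"
proof -
  have zero: "0 \<in> quadratic_field d"
    using quadratic_field_closed(5)[OF quadratic_field_closed(1) quadratic_field_closed(3)[OF quadratic_field_closed(1)]]
    by simp
  have nat: "of_nat j \<in> quadratic_field d" for j
    by (induction j) (auto simp: zero quadratic_field_closed)
  show ?thesis
    by (cases k) (use nat quadratic_field_closed(3) in \<open>auto simp del: of_nat_Suc\<close>)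
qed

lemma quadratic_field_subset:
  assumes "1 \<in> F" "csqrt (of_int d) \<in> F"
    and "\<And>x. x \<in> F \<Longrightarrow> - x \<in> F" "\<And>x. x \<in> F \<Longrightarrow> x \<noteq> 0 \<Longrightarrow> inverse x \<in> F"
    and "\<And>x y. x \<in> F \<Longrightarrow> y \<in> F \<Longrightarrow> x + y \<in> F" "\<And>x y. x \<in> F \<Longrightarrow> y \<in> F \<Longrightarrow> x * y \<in> F"
  shows "quadratic_field d \<subseteq> F"
proof
  fix x assume "x \<in> quadratic_field d"
  then show "x \<in> F"
    unfolding quadratic_field_def
    by (induction rule: generate_field.induct) (use assms in \<open>auto simp: complex_field_m_inv\<close>)
qed

text \<open>Completing the square turns \<open>s\<^sup>2\<close> into the discriminant. A nonreal
  number with real square is purely imaginary, so the discriminant equals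
  \<open>- (Im s)\<^sup>2\<close>.\<close>

lemma quadratic_imaginary_part:
  fixes x :: complex and a b c :: int
  assumes "a \<noteq> 0" "of_int a * x\<^sup>2 + of_int b * x + of_int c = 0" "Im x \<noteq> 0"
  defines "s \<equiv> 2 * of_int a * x + of_int b"
  shows "s\<^sup>2 = of_int (b\<^sup>2 - 4 * a * c)" and "Re s = 0" and "Im s \<noteq> 0" and "b\<^sup>2 - 4 * a * c < 0"
proof -
  have "s\<^sup>2 = 4 * of_int a * (of_int a * x\<^sup>2 + of_int b * x + of_int c) + of_int (b\<^sup>2 - 4 * a * c)"
    by (simp add: s_def power2_eq_square algebra_simps)
  then show sq: "s\<^sup>2 = of_int (b\<^sup>2 - 4 * a * c)" using assms(2) by simp
  show Im: "Im s \<noteq> 0" using assms(1,3) by (simp add: s_def)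
  have "Im (s\<^sup>2) = 0" unfolding sq by simp
  then show Re: "Re s = 0" using Im by (simp add: power2_eq_square)
  have "real_of_int (b\<^sup>2 - 4 * a * c) = Re (s\<^sup>2)" unfolding sq by simp
  also have "Re (s\<^sup>2) = - (Im s)\<^sup>2" using Re by (simp add: power2_eq_square)
  also have "\<dots> < 0" using Im by simp
  finally show "b\<^sup>2 - 4 * a * c < 0" by (simp only: of_int_less_0_iff)
qed

text \<open>Finite index is certified by a finite set \<open>S\<close> meeting every class modulo
  \<open>R\<close> of the ring of integers; elements of \<open>S\<close> may lie outside that
  ring.\<close>

lemma order_inI:
  assumes "R \<subseteq> ring_of_integers F" "1 \<in> R"
    and diff: "\<And>x y. x \<in> R \<Longrightarrow> y \<in> R \<Longrightarrow> x - y \<in> R"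
    and mult: "\<And>x y. x \<in> R \<Longrightarrow> y \<in> R \<Longrightarrow> x * y \<in> R"
    and "finite S" "\<And>x. x \<in> ring_of_integers F \<Longrightarrow> \<exists>y\<in>S. x - y \<in> R"
  shows "order_in F R"
proof -
  have zero: "0 \<in> R" using diff[OF assms(2) assms(2)] by simp
  have minus: "- x \<in> R" if "x \<in> R" for x using diff[OF zero that] by simp
  have add: "x + y \<in> R" if "x \<in> R" "y \<in> R" for x y
    using diff[OF that(1) minus[OF that(2)]] by simp
  let ?O = "complex_field\<lparr>carrier := ring_of_integers F\<rparr>"
  have inv: "m_inv (add_monoid ?O) x = - x" if "x \<in> R" for x
    unfolding m_inv_def
  proof (rule the_equality)
    show "- x \<in> carrier (add_monoid ?O) \<and> x \<otimes>\<^bsub>add_monoid ?O\<^esub> - x = \<one>\<^bsub>add_monoid ?O\<^esub> \<and>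
        - x \<otimes>\<^bsub>add_monoid ?O\<^esub> x = \<one>\<^bsub>add_monoid ?O\<^esub>"
      using assms(1) minus[OF that] by auto
  qed (auto simp: eq_neg_iff_add_eq_0 add.commute)
  have "subring R ?O"
  proof (rule subring.intro)
    show "subgroup R (add_monoid ?O)"
    proof (rule subgroup.intro)
      show "inv\<^bsub>add_monoid ?O\<^esub> x \<in> R" if "x \<in> R" for x
        unfolding inv[OF that] by (rule minus[OF that])
    qed (use assms zero add in auto)
    show "submonoid R ?O"
      by (rule submonoid.intro) (use assms mult in auto)
  qed
  moreover have "finite (a_rcosets\<^bsub>?O\<^esub> R)"
  proof -
    define coset where "coset x = (\<lambda>h. h + x) ` R" for x
    have eq: "coset x = coset y" if "x - y \<in> R" for x y
    proof -
      have "coset u \<subseteq> coset v" if uv: "u - v \<in> R" for u v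
      proof
        fix w assume "w \<in> coset u"
        then obtain h where h: "h \<in> R" "w = h + u" by (auto simp: coset_def)
        then have "w = (h + (u - v)) + v" by simp
        moreover have "h + (u - v) \<in> R" using h uv by (intro add)
        ultimately show "w \<in> coset v" unfolding coset_def by blast
      qed
      from this[OF that] this[of y x] minus[OF that] show ?thesis by auto
    qed
    have "a_rcosets\<^bsub>?O\<^esub> R = coset ` ring_of_integers F"
      by (auto simp: A_RCOSETS_def RCOSETS_def r_coset_def coset_def)
    also have "\<dots> \<subseteq> coset ` S"
      using assms(6) eq by blast
    finally show ?thesis using \<open>finite S\<close> finite_surj by blast
  qed
  ultimately show ?thesis by (simp add: order_in_def)
qed

section \<open>Classification of the rings with finite unit group\<close>

theorem theorem2p1:
  fixes R :: "complex set"
  assumes "subring R complex_field"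
    and "\<And>x. x \<in> R \<Longrightarrow> algebraic x"
    and "finite (Units (complex_field\<lparr>carrier := R\<rparr>))"
  shows "R = \<int> \<or> (\<exists>d::int. d < 0 \<and> order_in (quadratic_field d) R)"
proof -
  interpret algebraic_subring R
  proof
    note sub = subringE[OF assms(1)]
    show "1 \<in> R" using sub(3) by simp
    show "x * y \<in> R" if "x \<in> R" "y \<in> R" for x y using sub(6)[OF that] by simp
    show "x - y \<in> R" if "x \<in> R" "y \<in> R" for x y
      using sub(7)[OF that(1) sub(5)[OF that(2)]] by simp
  qed (rule assms(2))
  have "Units (complex_field\<lparr>carrier := R\<rparr>) = R_units"
    by (auto simp: Units_def R_units_def mult.commute)
  then have fin: "finite R_units" using assms(3) by simp
  note cases = finite_units_cases[OF fin]
  show ?thesis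
  proof (cases "R \<subseteq> \<int>")
    case True
    then show ?thesis using R_Ints by blast
  next
    case False
    then obtain \<alpha> where \<alpha>: "\<alpha> \<in> R" "\<alpha> \<notin> \<int>" by blast
    then obtain a b c :: int where abc: "a \<noteq> 0" "of_int a * \<alpha>\<^sup>2 + of_int b * \<alpha> + of_int c = 0"
      and Im\<alpha>: "Im \<alpha> \<noteq> 0"
      using cases[of \<alpha>] by blast
    \<comment> \<open>This is a purely imaginary element of \<open>R\<close> whose square is the
      discriminant of the equation for \<alpha>.\<close>
    define s where "s = 2 * of_int a * \<alpha> + of_int b"
    define d where "d = b\<^sup>2 - 4 * a * c"
    have s: "s\<^sup>2 = of_int d" "Re s = 0" "Im s \<noteq> 0" "d < 0"
      using quadratic_imaginary_part[OF abc Im\<alpha>] unfolding s_def d_def by auto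
    have sR: "s \<in> R"
      using R_add[OF R_mult[OF R_of_int[of "2 * a"] \<alpha>(1)] R_of_int[of b]] by (simp add: s_def)
    \<comment> \<open>The quadratic field is generated by the principal square root, from which
      \<open>s\<close> may differ in sign.\<close>
    have sqrt: "s = csqrt (of_int d) \<or> s = - csqrt (of_int d)"
      using s(1) power2_csqrt[of "of_int d"] by (metis power2_eq_iff)
    let ?F = "quadratic_field d"
    have sF: "s \<in> ?F"
      using sqrt quadratic_field_closed by metis
    have R_F: "x \<in> ?F" if x: "x \<in> R" for x
    proof (cases "x \<in> \<int>")
      case True
      then show ?thesis by (auto elim!: Ints_cases simp: quadratic_field_of_int)
    next
      case False
      then obtain a' b' c' :: int where abc': "a' \<noteq> 0" "of_int a' * x\<^sup>2 + of_int b' * x + of_int c' = 0"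
        and Imx: "Im x \<noteq> 0"
        using cases[OF x] by blast
      define t where "t = 2 * of_int a' * x + of_int b'"
      have t: "Re t = 0" using quadratic_imaginary_part(2)[OF abc' Imx] by (simp add: t_def)
      have tR: "t \<in> R"
        using R_add[OF R_mult[OF R_of_int[of "2 * a'"] x] R_of_int[of b']] by (simp add: t_def)
      \<comment> \<open>Both factors are purely imaginary. Their product is a real element of
        \<open>R\<close>, hence an integer, so \<open>t\<close> is an integer multiple of
        \<open>inverse s\<close>.\<close>
      have "Im (s * t) = 0" using s t by simp
      then have "s * t \<in> \<int>" using cases[OF R_mult[OF sR tR]] by blast
      then obtain k where "s * t = of_int k" by (auto elim: Ints_cases)
      moreover have "s \<noteq> 0" using s(3) by auto
      ultimately have "t = of_int k * inverse s" by (simp add: field_simps)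
      then have "t \<in> ?F" by (simp add: quadratic_field_closed quadratic_field_of_int sF)
      moreover have "x = (t + of_int (- b')) * inverse (of_int (2 * a'))"
        using abc'(1) by (simp add: t_def field_simps)
      ultimately show ?thesis
        using quadratic_field_closed(4,5,6) quadratic_field_of_int by metis
    qed
    have R_int: "R \<subseteq> ring_of_integers ?F"
      using R_F cases int_imp_algebraic_int unfolding ring_of_integers_def by blast
    \<comment> \<open>From here on \<open>Ord\<close> is \<int>[s] and \<open>K\<close> is
      \<rat>(s), with heights taken in the basis 1, \<open>s\<close>.\<close>
    interpret integral_power_basis R s 2
    proof
      show "\<exists>c :: nat \<Rightarrow> int. s ^ 2 = (\<Sum>i<2. of_int (c i) * s ^ i)"
        by (intro exI[of _ "\<lambda>i. if i = 0 then d else 0"]) (use s(1) in \<open>simp add: numeral_2_eq_2\<close>)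
      show "\<forall>i<2. r i = 0" if "(\<Sum>i<2. of_int (r i) * s ^ i) = 0" for r :: "nat \<Rightarrow> int"
      proof -
        have eq: "of_int (r 0) + of_int (r 1) * s = 0" using that by (simp add: numeral_2_eq_2)
        from arg_cong[OF eq, of Im] have "r 1 = 0" using s by simp
        moreover from this eq have "r 0 = 0" by simp
        ultimately show ?thesis by (auto simp: less_2_cases_iff)
      qed
    qed (rule sR)
    have F_K: "?F \<subseteq> K"
    proof (rule quadratic_field_subset)
      have "s \<in> K" using Ord_beta_power[of 1] Ord_KI by simp
      then show "csqrt (of_int d) \<in> K" using sqrt K_diff[OF K_zero, of s] by auto
      show "- x \<in> K" if "x \<in> K" for x using K_diff[OF K_zero that] by simp
    qed (auto simp: Ord_KI Ord_one K_inverse K_add K_mult)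
    \<comment> \<open>On \<int>[s] the squared absolute value is the form
      \<open>u\<^sup>2 - d * v\<^sup>2\<close>, a positive integer away from 0 because
      \<open>d < 0\<close>.\<close>
    have ge1: "norm y \<ge> 1" if y: "y \<in> Ord" "y \<noteq> 0" for y
    proof -
      obtain c where c: "y = lin c" "\<And>i. c i \<in> \<int>" using y(1) OrdE by metis
      obtain u v where uv: "c 0 = of_int u" "c 1 = of_int v" using c(2) by (metis Ints_cases)
      have "{..<2::nat} = {0, 1}" by auto
      then have yuv: "y = of_int u + of_int v * s" unfolding c(1) lin_def by (simp add: uv uv(2)[unfolded One_nat_def])
      have "(Im s)\<^sup>2 = - of_int d"
        using arg_cong[OF s(1), of Re] s(2) by (simp add: power2_eq_square)
      then have "(norm y)\<^sup>2 = of_int (u\<^sup>2 - d * v\<^sup>2)"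
        using s(2) by (simp add: yuv cmod_power2 power_mult_distrib)
      moreover have "u\<^sup>2 - d * v\<^sup>2 \<ge> 1"
      proof -
        have "u\<^sup>2 > 0 \<or> v\<^sup>2 > 0" using y(2) yuv by auto
        moreover have "d * v\<^sup>2 \<le> - 1 * v\<^sup>2" using s(4) by (intro mult_right_mono) auto
        moreover have "u\<^sup>2 \<ge> 0" "v\<^sup>2 \<ge> 0" by simp_all
        ultimately show ?thesis by linarith
      qed
      ultimately have "(norm y)\<^sup>2 \<ge> 1\<^sup>2" by (metis of_int_1_le_iff one_power2)
      then show ?thesis by (rule power2_le_imp_le) simp
    qed
    obtain N :: nat where N: "N > 0" "\<forall>x\<in>K. algebraic_int x \<longrightarrow> of_nat N * x \<in> Ord"
      using algebraic_int_uniform_denominator[OF ge1] by blast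
    have "order_in ?F R"
    proof (rule order_inI)
      \<comment> \<open>Coset representatives are the remainders of algebraic integers after
        rounding to \<int>[s]: they have denominator \<open>N\<close> and height at most 2.\<close>
      show "finite {x \<in> K. of_nat N * x \<in> Ord \<and> height x \<le> real 2}"
        by (rule finite_bounded_denominator) (use N in simp_all)
      fix x assume "x \<in> ring_of_integers ?F"
      then have x: "x \<in> K" "of_nat N * x \<in> Ord"
        using F_K N by (auto simp: ring_of_integers_def)
      then obtain z where z: "z \<in> Ord" "height (x - z) \<le> real 2" using ex_Ord_close by metis
      have "x - z \<in> {x \<in> K. of_nat N * x \<in> Ord \<and> height x \<le> real 2}"
        using x z K_diff Ord_KI Ord_diff Ord_scale_nat by (simp add: right_diff_distrib)
      moreover have "x - (x - z) \<in> R" using z(1) Ord_subset_R by auto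
      ultimately show "\<exists>y\<in>{x \<in> K. of_nat N * x \<in> Ord \<and> height x \<le> real 2}. x - y \<in> R" by blast
    qed (use R_int R_one R_diff R_mult in auto)
    then show ?thesis using s(4) by blast
  qed
qed

end
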